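(* Let $G$ be a torsion-free group and let $S=\bigoplus_{g\in G}S_g$ be an epsilon-strongly $G$-graded ring with principal component $R=S_e$. Then $S$ is left (respectively right) artinian if and only if $R$ is left (respectively right) artinian and $S_g=\{0\}$ for all but finitely many $g\in G$.
   Context: All rings are associative with multiplicative identity $1\neq 0$. A ring $S$ is $G$-graded if $S=\bigoplus_{g\in G}S_g$ for additive subgroups $S_g$ with $S_gS_h\subseteq S_{gh}$ for all $g,h\in G$; $S_e$ ($e$ the neutral element) is the principal component. $S$ is epsilon-strongly $G$-graded if (a) $S_gS_{g^{-1}}S_g=S_g$ for all $g\in G$, and (b) for each $g\in G$ the ideal $S_gS_{g^{-1}}$ of $S_e$ has a multiplicative identity. *)

theory Defs
  imports "HOL-Algebra.Algebra"
begin

definition torsion_free_group :: "('g, 'b) monoid_scheme \<Rightarrow> bool" where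
  "torsion_free_group G \<longleftrightarrow> group G \<and>
     (\<forall>g\<in>carrier G. \<forall>n::nat. n > 0 \<and> g [^]\<^bsub>G\<^esub> n = \<one>\<^bsub>G\<^esub> \<longrightarrow> g = \<one>\<^bsub>G\<^esub>)"

definition ring_setmult :: "('a, 'c) ring_scheme \<Rightarrow> 'a set \<Rightarrow> 'a set \<Rightarrow> 'a set" where
  "ring_setmult S A B = generate (add_monoid S) {a \<otimes>\<^bsub>S\<^esub> b | a b. a \<in> A \<and> b \<in> B}"

definition graded_ring :: "('g, 'b) monoid_scheme \<Rightarrow> ('a, 'c) ring_scheme \<Rightarrow> ('g \<Rightarrow> 'a set) \<Rightarrow> bool" where
  "graded_ring G S c \<longleftrightarrow> group G \<and> ring S \<and> \<one>\<^bsub>S\<^esub> \<noteq> \<zero>\<^bsub>S\<^esub> \<and>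
     (\<forall>g\<in>carrier G. additive_subgroup (c g) S) \<and>
     (\<forall>g\<in>carrier G. \<forall>h\<in>carrier G. \<forall>x\<in>c g. \<forall>y\<in>c h. x \<otimes>\<^bsub>S\<^esub> y \<in> c (g \<otimes>\<^bsub>G\<^esub> h)) \<and>
     (\<forall>x\<in>carrier S. \<exists>A f. finite A \<and> A \<subseteq> carrier G \<and> (\<forall>g\<in>A. f g \<in> c g) \<and>
          x = finsum S f A) \<and>
     (\<forall>A f. finite A \<and> A \<subseteq> carrier G \<and> (\<forall>g\<in>A. f g \<in> c g) \<and> finsum S f A = \<zero>\<^bsub>S\<^esub>
          \<longrightarrow> (\<forall>g\<in>A. f g = \<zero>\<^bsub>S\<^esub>))"

definition epsilon_strongly_graded :: "('g, 'b) monoid_scheme \<Rightarrow> ('a, 'c) ring_scheme \<Rightarrow> ('g \<Rightarrow> 'a set) \<Rightarrow> bool" where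
  "epsilon_strongly_graded G S c \<longleftrightarrow> graded_ring G S c \<and>
     (\<forall>g\<in>carrier G.
        ring_setmult S (ring_setmult S (c g) (c (inv\<^bsub>G\<^esub> g))) (c g) = c g \<and>
        (\<exists>\<epsilon>\<in>ring_setmult S (c g) (c (inv\<^bsub>G\<^esub> g)).
           \<forall>x\<in>ring_setmult S (c g) (c (inv\<^bsub>G\<^esub> g)). \<epsilon> \<otimes>\<^bsub>S\<^esub> x = x \<and> x \<otimes>\<^bsub>S\<^esub> \<epsilon> = x))"

definition left_ideal :: "'a set \<Rightarrow> ('a, 'c) ring_scheme \<Rightarrow> bool" where
  "left_ideal I R \<longleftrightarrow> additive_subgroup I R \<and> (\<forall>r\<in>carrier R. \<forall>x\<in>I. r \<otimes>\<^bsub>R\<^esub> x \<in> I)"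

definition right_ideal :: "'a set \<Rightarrow> ('a, 'c) ring_scheme \<Rightarrow> bool" where
  "right_ideal I R \<longleftrightarrow> additive_subgroup I R \<and> (\<forall>r\<in>carrier R. \<forall>x\<in>I. x \<otimes>\<^bsub>R\<^esub> r \<in> I)"

definition left_artinian :: "('a, 'c) ring_scheme \<Rightarrow> bool" where
  "left_artinian R \<longleftrightarrow> (\<forall>I :: nat \<Rightarrow> 'a set.
     (\<forall>n. left_ideal (I n) R) \<and> (\<forall>n. I (Suc n) \<subseteq> I n) \<longrightarrow> (\<exists>N. \<forall>n\<ge>N. I n = I N))"

definition right_artinian :: "('a, 'c) ring_scheme \<Rightarrow> bool" where
  "right_artinian R \<longleftrightarrow> (\<forall>I :: nat \<Rightarrow> 'a set.
     (\<forall>n. right_ideal (I n) R) \<and> (\<forall>n. I (Suc n) \<subseteq> I n) \<longrightarrow> (\<exists>N. \<forall>n\<ge>N. I n = I N))"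

end

theory Submission
  imports Defs
begin

text \<open>
  Write \<open>R = S\<^sub>e\<close>. The substance is that an artinian \<open>S\<close> has finite support. If \<open>x\<close> is homogeneous of
  degree \<open>g \<noteq> e\<close>, the descending chain of the \<open>S (1 - x)\<^sup>n\<close> forces \<open>1 - x\<close> to be left invertible; as
  \<open>g\<close> has infinite order the inverse must be the geometric series, so \<open>x\<close> is nilpotent.
  If the support were infinite, choose an idempotent \<open>f \<in> R\<close> with \<open>R f\<close> minimal such that \<open>S\<^sub>g f \<noteq> 0\<close>
  for infinitely many \<open>g\<close>. Then \<open>f\<close> is primitive, \<open>f R f\<close> is local with nil radical, and the
  local units of the grading give \<open>u\<^sub>g \<in> S\<^sub>g f\<close> and \<open>v\<^sub>g \<in> f S\<^bsub>g\<inverse>\<^esub>\<close> with \<open>v\<^sub>g u\<^sub>g = f\<close>. For \<open>g \<noteq> h\<close> the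
  elements of \<open>v\<^sub>g R u\<^sub>h\<close> have degree different from \<open>e\<close>, hence are nilpotent, so the idempotents
  \<open>u\<^sub>g v\<^sub>g\<close> are pairwise non-isomorphic in \<open>R\<close>. The left ideals \<open>{r. v\<^sub>g R r u\<^sub>g is nil}\<close>
  then intersect to an infinite strictly descending chain in the artinian ring \<open>R\<close>.
  Conversely every \<open>S\<^sub>g\<close> is finitely generated over \<open>R\<close>. The right-handed statement is the left-handed
  one for the opposite ring, graded by \<open>g \<mapsto> S\<^bsub>g\<inverse>\<^esub>\<close>.
\<close>

section \<open>Local corners of left artinian rings\<close>

text \<open>Passes from the chain condition to minimal members: without one, iterating a choice of
  strictly smaller members from any starting ideal would give a chain that never stops.\<close>

lemma left_artinian_minimal:
  assumes "left_artinian R" and "F \<noteq> {}" and "\<And>I. I \<in> F \<Longrightarrow> left_ideal I R"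
  shows "\<exists>I\<in>F. \<forall>J\<in>F. J \<subseteq> I \<longrightarrow> J = I"
proof (rule ccontr)
  assume "\<not> ?thesis"
  then have "\<forall>I. \<exists>J. I \<in> F \<longrightarrow> J \<in> F \<and> J \<subset> I" by blast
  then obtain h where h: "\<And>I. I \<in> F \<Longrightarrow> h I \<in> F \<and> h I \<subset> I" by metis
  obtain I0 where "I0 \<in> F" using assms(2) by blast
  have mem: "(h ^^ n) I0 \<in> F" for n by (induction n) (use h \<open>I0 \<in> F\<close> in auto)
  have dec: "(h ^^ Suc n) I0 \<subset> (h ^^ n) I0" for n using h[OF mem[of n]] by simp
  obtain N where "\<forall>n\<ge>N. (h ^^ n) I0 = (h ^^ N) I0"
    using assms(1)[unfolded left_artinian_def, rule_format, of "\<lambda>n. (h ^^ n) I0"]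
      mem assms(3) dec by (metis psubset_imp_subset)
  then show False using dec[of N] by (metis le_SucI order_refl psubset_eq)
qed

context ring
begin

lemma additive_subgroupI':
  assumes "I \<subseteq> carrier R" "\<zero> \<in> I"
    and "\<And>x y. x \<in> I \<Longrightarrow> y \<in> I \<Longrightarrow> x \<oplus> y \<in> I" and "\<And>x. x \<in> I \<Longrightarrow> \<ominus> x \<in> I"
  shows "additive_subgroup I R"
  using assms by (auto intro!: additive_subgroup.intro add.subgroupI)

lemma left_ideal_principal:
  assumes "a \<in> carrier R"
  shows "left_ideal ((\<lambda>r. r \<otimes> a) ` carrier R) R"
  unfolding left_ideal_def
proof (intro conjI ballI additive_subgroupI')
  show "\<zero> \<in> (\<lambda>r. r \<otimes> a) ` carrier R" using assms by (intro image_eqI[of _ _ \<zero>]) auto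
next
  fix x y assume "x \<in> (\<lambda>r. r \<otimes> a) ` carrier R" "y \<in> (\<lambda>r. r \<otimes> a) ` carrier R"
  then obtain r s where "r \<in> carrier R" "s \<in> carrier R" "x = r \<otimes> a" "y = s \<otimes> a" by auto
  then show "x \<oplus> y \<in> (\<lambda>r. r \<otimes> a) ` carrier R"
    using assms by (intro image_eqI[of _ _ "r \<oplus> s"]) (auto simp: l_distr)
next
  fix x assume "x \<in> (\<lambda>r. r \<otimes> a) ` carrier R"
  then obtain r where "r \<in> carrier R" "x = r \<otimes> a" by auto
  then show "\<ominus> x \<in> (\<lambda>r. r \<otimes> a) ` carrier R"
    using assms by (intro image_eqI[of _ _ "\<ominus> r"]) (auto simp: l_minus)
next
  fix s x assume "s \<in> carrier R" "x \<in> (\<lambda>r. r \<otimes> a) ` carrier R"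
  then obtain r where "r \<in> carrier R" "x = r \<otimes> a" by auto
  then show "s \<otimes> x \<in> (\<lambda>r. r \<otimes> a) ` carrier R"
    using assms \<open>s \<in> carrier R\<close> by (intro image_eqI[of _ _ "s \<otimes> r"]) (auto simp: m_assoc)
qed (use assms in auto)

text \<open>The left ideals \<open>R a^n\<close> descend, and at a stationary index
  \<open>a^N\<close> itself lies in \<open>R a^(N+1)\<close>. Later \<open>a\<close> is
  \<open>1 - x\<close> with \<open>x\<close> homogeneous.\<close>

lemma left_artinian_power_stable:
  assumes "left_artinian R" and a: "a \<in> carrier R"
  shows "\<exists>n. \<exists>t\<in>carrier R. a [^] n = t \<otimes> a [^] Suc n"
proof -
  let ?I = "\<lambda>n::nat. (\<lambda>r. r \<otimes> a [^] n) ` carrier R"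
  have "?I (Suc n) \<subseteq> ?I n" for n
  proof
    fix x assume "x \<in> ?I (Suc n)"
    then obtain r where "r \<in> carrier R" "x = r \<otimes> a [^] Suc n" by blast
    then show "x \<in> ?I n"
      using a by (intro image_eqI[of _ _ "r \<otimes> a"]) (auto simp: nat_pow_Suc2[symmetric] m_assoc)
  qed
  then obtain N where N: "\<forall>n\<ge>N. ?I n = ?I N"
    using assms(1)[unfolded left_artinian_def, rule_format, of ?I] left_ideal_principal a by blast
  have "a [^] N \<in> ?I N" using a by (intro image_eqI[of _ _ \<one>]) auto
  then have "a [^] N \<in> ?I (Suc N)" using N by (metis le_SucI order_refl)
  then show ?thesis by blast
qed

section \<open>Nilpotent elements, corners, and powers of commuting elements\<close>

definition nilp :: "'a \<Rightarrow> bool" where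
  "nilp a \<longleftrightarrow> (\<exists>n::nat. a [^] n = \<zero>)"

text \<open>For idempotent \<open>e\<close> this is the Peirce corner \<open>e R e\<close>, written
  as a set of fixed points so that membership needs no witness.\<close>

definition corner :: "'a \<Rightarrow> 'a set" where
  "corner e = {x \<in> carrier R. e \<otimes> x = x \<and> x \<otimes> e = x}"

text \<open>The innermost factor \<open>p q\<close> collapses to \<open>e\<close>, which the next
  \<open>q\<close> absorbs. Exponents start at 1 because at exponent 0 the product is
  \<open>1\<close> and not \<open>e\<close>.\<close>

lemma power_left_inverse:
  assumes "p \<in> carrier R" "q \<in> carrier R" "e \<in> carrier R" "p \<otimes> q = e" "e \<otimes> q = q"
  shows "p [^] Suc n \<otimes> q [^] Suc n = e"
proof (induction n)
  case 0 then show ?case using assms by simp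
next
  case (Suc n)
  have "e \<otimes> q [^] k = q [^] k" if "k > 0" for k :: nat
    using that
  proof (cases k)
    case (Suc m)
    then show ?thesis using assms
      by (metis nat_pow_Suc2 nat_pow_closed m_assoc)
  qed auto
  have "p [^] Suc (Suc n) \<otimes> q [^] Suc (Suc n) = (p \<otimes> p [^] Suc n) \<otimes> (q [^] Suc n \<otimes> q)"
    by (metis assms(1) nat_pow_Suc nat_pow_Suc2)
  also have "\<dots> = p \<otimes> (p [^] Suc n \<otimes> q [^] Suc n) \<otimes> q"
    using assms by (simp add: m_assoc del: nat_pow_Suc)
  also have "\<dots> = e" using assms Suc by (simp add: m_assoc del: nat_pow_Suc)
  finally show ?case .
qed

text \<open>If a power of either factor vanished, so would some product
  \<open>p^(n+1) q^(n+1)\<close>, which equals \<open>e\<close>. Most contradictions below are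
  obtained in this way.\<close>

lemma left_inverse_not_nilp:
  assumes "p \<in> carrier R" "q \<in> carrier R" "e \<in> carrier R" "p \<otimes> q = e" "e \<otimes> q = q" "e \<noteq> \<zero>"
  shows "\<not> nilp p" and "\<not> nilp q"
proof -
  have z: "x [^] Suc n = \<zero>" if "x [^] n = \<zero>" "x \<in> carrier R" for x and n :: nat
    using that by simp
  show "\<not> nilp p"
    using power_left_inverse[OF assms(1-5)] z assms unfolding nilp_def
    by (metis l_null nat_pow_closed)
  show "\<not> nilp q"
    using power_left_inverse[OF assms(1-5)] z assms unfolding nilp_def
    by (metis r_null nat_pow_closed)
qed

text \<open>By the binomial expansion \<open>1 - (1 - c)^n\<close> is \<open>c\<close> times a
  polynomial \<open>q\<close> in \<open>c\<close>; of that polynomial only its commuting with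
  \<open>c\<close> is recorded.\<close>

lemma one_minus_power:
  assumes c: "c \<in> carrier R"
  shows "\<exists>q\<in>carrier R. q \<otimes> c = c \<otimes> q \<and> (\<one> \<ominus> c) [^] (n::nat) = \<one> \<ominus> c \<otimes> q"
proof (induction n)
  case 0
  then show ?case using c by (intro bexI[of _ \<zero>]) (auto simp: minus_eq)
next
  case (Suc n)
  then obtain q where q: "q \<in> carrier R" "q \<otimes> c = c \<otimes> q" "(\<one> \<ominus> c) [^] n = \<one> \<ominus> c \<otimes> q" by blast
  \<comment> \<open>Read off from \<open>(1 - c q)(1 - c) = 1 - c (q + 1 - q c)\<close>.\<close>
  let ?q = "q \<oplus> (\<one> \<ominus> q \<otimes> c)"
  have "(\<one> \<ominus> c \<otimes> q) \<otimes> (\<one> \<ominus> c) = \<one> \<ominus> c \<otimes> ?q"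
    using c q(1) by (simp add: minus_eq l_distr r_distr l_minus r_minus minus_add m_assoc a_ac)
  moreover have "?q \<otimes> c = c \<otimes> ?q"
    using c q by (simp add: minus_eq l_distr r_distr l_minus r_minus) (metis m_assoc q(2))
  ultimately show ?case using q c by (intro bexI[of _ ?q]) auto
qed

lemma power_comm:
  assumes "x \<in> carrier R" "y \<in> carrier R" "x \<otimes> y = y \<otimes> x"
  shows "x [^] (n::nat) \<otimes> y = y \<otimes> x [^] n"
  by (induction n) (use assms in \<open>auto simp: m_assoc\<close>, metis m_assoc nat_pow_closed)

text \<open>A Fitting argument: iterating the hypothesis \<open>n\<close> times gives
  \<open>c^n = c^(2n) q^n\<close>. Hence \<open>c^n q^n\<close> fixes \<open>c^n\<close> from the
  left, and multiplying by \<open>q^n\<close> shows that it is idempotent.\<close>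

lemma idempotent_of_power_stable:
  assumes c: "c \<in> carrier R" and q: "q \<in> carrier R" "q \<otimes> c = c \<otimes> q"
    and n: "c [^] n = c [^] Suc n \<otimes> q"
  shows "(c [^] n \<otimes> q [^] n) \<otimes> (c [^] n \<otimes> q [^] n) = c [^] n \<otimes> q [^] n"
    and "(c [^] n \<otimes> q [^] n) \<otimes> c [^] n = c [^] n"
proof -
  have comm: "q [^] k \<otimes> c [^] m = c [^] m \<otimes> q [^] k" for k m :: nat
    using power_comm[of q c k] power_comm[of c "q [^] k" m] c q by simp
  have st: "c [^] n = c [^] (n + k) \<otimes> q [^] k" for k
  proof (induction k)
    case (Suc k)
    have "c [^] (n + k) = c [^] (n + Suc k) \<otimes> q"
    proof -
      have "c [^] (n + k) = c [^] k \<otimes> c [^] n" using c by (simp add: nat_pow_mult add.commute)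
      also have "\<dots> = c [^] k \<otimes> (c [^] Suc n \<otimes> q)" using n by simp
      also have "\<dots> = c [^] (n + Suc k) \<otimes> q"
        using c q by (simp add: m_assoc[symmetric] nat_pow_mult add.commute del: nat_pow_Suc)
      finally show ?thesis .
    qed
    then have "c [^] n = c [^] (n + Suc k) \<otimes> (q \<otimes> q [^] k)"
      using Suc c q by (metis m_assoc nat_pow_closed)
    then show ?case using q by (metis nat_pow_Suc2)
  qed (use c in simp)
  have st2: "c [^] n = c [^] n \<otimes> c [^] n \<otimes> q [^] n" unfolding nat_pow_mult[OF c] by (rule st)
  then show id2: "(c [^] n \<otimes> q [^] n) \<otimes> c [^] n = c [^] n"
    using comm[of n n] c q by (simp add: m_assoc)
  show "(c [^] n \<otimes> q [^] n) \<otimes> (c [^] n \<otimes> q [^] n) = c [^] n \<otimes> q [^] n"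
    using id2 c q by (simp add: m_assoc[symmetric])
qed

lemma corner_mult: "e \<in> carrier R \<Longrightarrow> x \<in> corner e \<Longrightarrow> y \<in> corner e \<Longrightarrow> x \<otimes> y \<in> corner e"
  unfolding corner_def by (auto simp: m_assoc) (metis m_assoc)

lemma corner_sandwich:
  assumes "e \<in> carrier R" "e \<otimes> e = e" "x \<in> carrier R"
  shows "e \<otimes> x \<otimes> e \<in> corner e"
  using assms unfolding corner_def by (simp add: m_assoc) (metis m_assoc m_closed)

text \<open>Brauer's argument: if \<open>R b\<close> is minimal among the left ideals generated by a non-nilpotent
  element of the corner, then \<open>b = c b\<close> with \<open>c \<in> R b\<close>, and \<open>c\<close> is idempotent modulo nilpotents.\<close>

lemma primitive_idempotent_corner_left_inverse:
  assumes art: "left_artinian R"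
    and e: "e \<in> carrier R" "e \<otimes> e = e"
    and prim: "\<And>f. f \<in> corner e \<Longrightarrow> f \<otimes> f = f \<Longrightarrow> f = \<zero> \<or> f = e"
    and a: "a \<in> corner e" "\<not> nilp a"
  shows "\<exists>t\<in>corner e. t \<otimes> a = e"
proof -
  let ?L = "\<lambda>b. (\<lambda>r. r \<otimes> b) ` carrier R"
  \<comment> \<open>The candidates stay below \<open>R a\<close>, so that finding \<open>e\<close>
    in the minimal \<open>R b\<close> also puts \<open>e\<close> into \<open>R a\<close>.\<close>
  let ?F = "?L ` {b \<in> corner e. \<not> nilp b \<and> ?L b \<subseteq> ?L a}"
  have cc: "x \<in> carrier R" if "x \<in> corner e" for x using that unfolding corner_def by simp
  have self: "b \<in> ?L b" if "b \<in> corner e" for b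
    using cc[OF that] by (intro image_eqI[of _ _ \<one>]) auto
  have sub: "?L (r \<otimes> b) \<subseteq> ?L b" if "r \<in> carrier R" "b \<in> carrier R" for r b
  proof
    fix x assume "x \<in> ?L (r \<otimes> b)"
    then obtain s where "s \<in> carrier R" "x = s \<otimes> (r \<otimes> b)" by blast
    then show "x \<in> ?L b" using that by (intro image_eqI[of _ _ "s \<otimes> r"]) (auto simp: m_assoc)
  qed
  have "?F \<noteq> {}" using a by blast
  moreover have "left_ideal I R" if "I \<in> ?F" for I using that left_ideal_principal cc by blast
  ultimately obtain I where I: "I \<in> ?F" "\<forall>J\<in>?F. J \<subseteq> I \<longrightarrow> J = I"
    using left_artinian_minimal[OF art, of ?F] by blast
  then obtain b where b: "b \<in> corner e" "\<not> nilp b" "?L b \<subseteq> ?L a" and Ib: "I = ?L b" by blast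
  have min: "?L (r \<otimes> b) = ?L b" if "r \<in> carrier R" "r \<otimes> b \<in> corner e" "\<not> nilp (r \<otimes> b)" for r
  proof -
    have "?L (r \<otimes> b) \<subseteq> ?L b" using sub that(1) cc b(1) by blast
    moreover have "?L (r \<otimes> b) \<in> ?F" using calculation that b(3) by blast
    ultimately show ?thesis using I(2) Ib by blast
  qed
  have bR: "b \<in> carrier R" "e \<otimes> b = b" "b \<otimes> e = b" using b(1) unfolding corner_def by auto
  \<comment> \<open>With \<open>b^2\<close> not nilpotent, minimality gives
    \<open>R b^2 = R b\<close>, and therefore \<open>b = t b^2\<close> for some
    \<open>t\<close>.\<close>
  have "\<not> nilp (b \<otimes> b)"
  proof
    assume "nilp (b \<otimes> b)"
    then obtain n :: nat where "(b \<otimes> b) [^] n = \<zero>" unfolding nilp_def by blast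
    moreover have "b \<otimes> b = b [^] (2::nat)" using bR by (simp add: numeral_2_eq_2)
    ultimately have "b [^] (2 * n) = \<zero>" using bR by (simp add: nat_pow_pow)
    then show False using b(2) unfolding nilp_def by blast
  qed
  then have "?L (b \<otimes> b) = ?L b" using min[OF bR(1)] corner_mult e b by blast
  then obtain t where t: "t \<in> carrier R" "b = t \<otimes> (b \<otimes> b)" using self[OF b(1)] by auto
  \<comment> \<open>The factor \<open>e\<close> moves \<open>t b\<close> into the corner without
    spoiling \<open>c b = b\<close>. All powers of \<open>c\<close> fix \<open>b\<close> as well, so
    none of them is zero.\<close>
  define c where "c = (e \<otimes> t) \<otimes> b"
  have cR: "c \<in> carrier R" unfolding c_def using e t bR by simp
  have cb: "c \<otimes> b = b"
    unfolding c_def using e t bR by (metis m_assoc m_closed)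
  have cc: "c \<in> corner e" unfolding c_def corner_def using e t bR
    by (simp add: m_assoc) (metis m_assoc m_closed)
  have ec: "e \<otimes> c = c" "c \<otimes> e = c" using cc unfolding corner_def by auto
  have pc: "c [^] n \<otimes> b = b" for n :: nat
    by (induction n) (use cR bR cb in \<open>auto simp: m_assoc\<close>)
  have bne: "b \<noteq> \<zero>"
  proof
    assume "b = \<zero>"
    then have "b [^] (1::nat) = \<zero>" by simp
    then show False using b(2) unfolding nilp_def by blast
  qed
  then have cn: "c [^] n \<noteq> \<zero>" for n :: nat using pc[of n] bR by force
  \<comment> \<open>Otherwise minimality applies to this element of \<open>R b\<close> and yields
    \<open>b = w c (1 - c)\<close>. Since \<open>(1 - c) b = 0\<close>, this gives
    \<open>b^2 = 0\<close>, contrary to the choice of \<open>b\<close>.\<close>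
  have nil: "nilp (c \<otimes> (\<one> \<ominus> c))"
  proof (rule ccontr)
    assume n: "\<not> nilp (c \<otimes> (\<one> \<ominus> c))"
    have eq: "c \<otimes> (\<one> \<ominus> c) = ((\<one> \<ominus> c) \<otimes> (e \<otimes> t)) \<otimes> b"
    proof -
      have "c \<otimes> (\<one> \<ominus> c) = (\<one> \<ominus> c) \<otimes> c"
        using cR by (simp add: minus_eq l_distr r_distr l_minus r_minus)
      then show ?thesis unfolding c_def using e t bR by (simp add: m_assoc)
    qed
    have mem: "c \<otimes> (\<one> \<ominus> c) \<in> corner e"
      using cR e ec unfolding corner_def
      by (simp add: minus_eq r_distr r_minus l_distr l_minus m_assoc m_assoc[symmetric, of e])
    have "?L (((\<one> \<ominus> c) \<otimes> (e \<otimes> t)) \<otimes> b) = ?L b"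
      by (rule min) (use n mem eq e t cR in auto)
    then obtain w where w: "w \<in> carrier R" "b = w \<otimes> (c \<otimes> (\<one> \<ominus> c))" using self[OF b(1)] eq by auto
    have "(\<one> \<ominus> c) \<otimes> b = \<zero>" using cb cR bR by (simp add: minus_eq l_distr l_minus r_neg)
    then have "b \<otimes> b = \<zero>" using w cR bR by (metis m_assoc m_closed minus_closed one_closed r_null)
    then have "b [^] (2::nat) = \<zero>" using bR by (simp add: numeral_2_eq_2)
    then show False using b(2) unfolding nilp_def by blast
  qed
  then obtain n :: nat where n: "(c \<otimes> (\<one> \<ominus> c)) [^] n = \<zero>" unfolding nilp_def by blast
  \<comment> \<open>A positive exponent is required later, when one factor \<open>c\<close> is split
    off from \<open>c^n\<close>.\<close>
  have n0: "n > 0"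
  proof (rule ccontr)
    assume "\<not> n > 0"
    then have "\<one> = \<zero>" using n by simp
    then show False using bne bR by (metis l_one l_null)
  qed
  obtain q where q: "q \<in> carrier R" "q \<otimes> c = c \<otimes> q" "(\<one> \<ominus> c) [^] n = \<one> \<ominus> c \<otimes> q"
    using one_minus_power[OF cR] by blast
  have "c \<otimes> (\<one> \<ominus> c) = (\<one> \<ominus> c) \<otimes> c"
    using cR by (simp add: minus_eq l_distr r_distr l_minus r_minus)
  \<comment> \<open>The nilpotent power splits as \<open>c^n (1 - c)^n\<close> because the factors
    commute. Expanding the second one gives \<open>c^n = c^(n+1) q\<close>, the input for lifting
    the idempotent.\<close>
  then have "c [^] n \<otimes> (\<one> \<ominus> c \<otimes> q) = \<zero>"
    using n q cR by (metis pow_mult_distrib minus_closed one_closed)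
  then have "c [^] n = c [^] Suc n \<otimes> q"
    using cR q by (simp add: minus_eq r_distr r_minus m_assoc) (metis a_minus_def m_closed nat_pow_closed r_right_minus_eq)
  note f = idempotent_of_power_stable[OF cR q(1,2) this]
  \<comment> \<open>This lifted idempotent is nonzero since it fixes \<open>c^n\<close>, and it lies
    in the corner because a factor \<open>c\<close> can be pulled out on either side. Primitivity
    makes it \<open>e\<close>, whence \<open>e\<close> lies in \<open>R c\<close> and so in
    \<open>R b\<close>.\<close>
  let ?f = "c [^] n \<otimes> q [^] n"
  obtain m where m: "n = Suc m" using n0 by (cases n) auto
  have fc: "?f = c \<otimes> (c [^] m \<otimes> q [^] n)" 
    using cR q by (metis m m_assoc nat_pow_Suc2 nat_pow_closed)
  have qc: "q [^] n \<otimes> c = c \<otimes> q [^] n" using power_comm q cR by simp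
  have fc2: "?f = (c [^] m \<otimes> q [^] n) \<otimes> c" 
    using cR q m qc by (simp add: m_assoc)
  have "e \<otimes> ?f = ?f" unfolding fc using ec e cR q by (metis m_assoc m_closed nat_pow_closed)
  moreover have "?f \<otimes> e = ?f" unfolding fc2 using ec e cR q by (metis m_assoc m_closed nat_pow_closed)
  ultimately have "?f \<in> corner e" unfolding corner_def using cR q by simp
  moreover have "?f \<noteq> \<zero>" using f(2) cn[of n] cR by force
  ultimately have "?f = e" using prim f(1) by blast
  then have "e = (c [^] m \<otimes> q [^] n \<otimes> (e \<otimes> t)) \<otimes> b" using fc2 e t bR cR q
    unfolding c_def by (simp add: m_assoc)
  then have "e \<in> ?L b" using e t bR cR q by (metis image_eqI m_closed nat_pow_closed)
  then obtain w where w: "w \<in> carrier R" "e = w \<otimes> a" using b(3) by blast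
  have aR: "a \<in> carrier R" "e \<otimes> a = a" using a unfolding corner_def by auto
  have "(e \<otimes> w \<otimes> e) \<otimes> a = e" using w e aR by (metis m_assoc m_closed)
  then show ?thesis using corner_sandwich e w by blast
qed

text \<open>The corner is local. A left inverse \<open>w\<close> of a non-nilpotent sum would write
  \<open>e\<close> as a sum of the nilpotents \<open>w a\<close> and \<open>w b\<close>; expanding a
  power of \<open>e - w a\<close> then gives \<open>w a\<close> a right inverse relative to
  \<open>e\<close>, which no nilpotent has.\<close>

lemma primitive_idempotent_corner_nilp_add:
  assumes art: "left_artinian R"
    and e: "e \<in> carrier R" "e \<otimes> e = e" "e \<noteq> \<zero>"
    and prim: "\<And>f. f \<in> corner e \<Longrightarrow> f \<otimes> f = f \<Longrightarrow> f = \<zero> \<or> f = e"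
    and a: "a \<in> corner e" "nilp a" and b: "b \<in> corner e" "nilp b"
  shows "nilp (a \<oplus> b)"
proof (rule ccontr)
  assume n: "\<not> nilp (a \<oplus> b)"
  note inv = primitive_idempotent_corner_left_inverse[OF art e(1,2) prim]
  have cR: "x \<in> carrier R" "e \<otimes> x = x" "x \<otimes> e = x" if "x \<in> corner e" for x
    using that unfolding corner_def by auto
  have "a \<oplus> b \<in> corner e"
    using cR[OF a(1)] cR[OF b(1)] e unfolding corner_def by (simp add: l_distr r_distr)
  then obtain w where w: "w \<in> corner e" "w \<otimes> (a \<oplus> b) = e" using inv n by blast
  \<comment> \<open>A left inverse \<open>t\<close> of \<open>w d\<close> would make
    \<open>t w\<close> a left inverse of the nilpotent \<open>d\<close>.\<close>
  have wn: "nilp (w \<otimes> d)" if d: "d \<in> corner e" "nilp d" for d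
  proof (rule ccontr)
    assume "\<not> nilp (w \<otimes> d)"
    then obtain t where "t \<in> corner e" "t \<otimes> (w \<otimes> d) = e"
      using inv corner_mult[OF e(1) w(1) d(1)] by blast
    then show False
      using left_inverse_not_nilp(2)[of "t \<otimes> w" d e] cR w(1) d e by (simp add: m_assoc)
  qed
  define x where "x = w \<otimes> a"
  have x: "x \<in> carrier R" "e \<otimes> x = x" "x \<otimes> e = x" "nilp x"
    using wn[OF a] cR[OF corner_mult[OF e(1) w(1) a(1)]] unfolding x_def by auto
  have "x \<oplus> w \<otimes> b = e" using w cR a(1) b(1) unfolding x_def by (simp add: r_distr)
  then have "w \<otimes> b = e \<ominus> x"
    using x e cR w(1) b(1)
    by (metis a_minus_def add.inv_closed add.m_closed add.m_comm m_closed minus_minus r_neg1)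
  then have wb: "w \<otimes> b = e \<otimes> (\<one> \<ominus> x)" using x e by (simp add: minus_eq r_distr r_minus)
  have comm: "e \<otimes> (\<one> \<ominus> x) = (\<one> \<ominus> x) \<otimes> e"
    using x e by (simp add: minus_eq r_distr l_distr r_minus l_minus)
  obtain n :: nat where n: "(w \<otimes> b) [^] n = \<zero>" using wn[OF b] unfolding nilp_def by blast
  \<comment> \<open>The exponent is raised by one so that the power of \<open>e\<close> is
    \<open>e\<close> even for \<open>n = 0\<close>.\<close>
  obtain q where q: "q \<in> carrier R" "(\<one> \<ominus> x) [^] Suc n = \<one> \<ominus> x \<otimes> q"
    using one_minus_power[OF x(1), of "Suc n"] by blast
  have en: "e [^] Suc k = e" for k by (induction k) (use e in auto)
  have "\<zero> = (w \<otimes> b) [^] Suc n" using n cR w(1) b(1) by simp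
  also have "\<dots> = e \<otimes> (\<one> \<ominus> x \<otimes> q)"
    unfolding wb using pow_mult_distrib[OF comm, of "Suc n"] e x q en by (metis minus_closed one_closed)
  also have "\<dots> = e \<ominus> x \<otimes> q" using e x q by (simp add: minus_eq r_distr r_minus m_assoc[symmetric])
  finally have "x \<otimes> q = e" using x q e by (metis m_closed r_right_minus_eq)
  \<comment> \<open>Replacing \<open>q\<close> by \<open>e q\<close> ensures that \<open>e\<close>
    acts as a left identity on the right inverse.\<close>
  then have "x \<otimes> (e \<otimes> q) = e" using x q e by (simp add: m_assoc[symmetric])
  then show False
    using left_inverse_not_nilp(1)[of x "e \<otimes> q" e] x q e by (simp add: m_assoc[symmetric])
qed

end

section \<open>Homogeneous components\<close>

locale graded = ring S + G: group G
  for S :: "('a, 'c) ring_scheme" (structure) and G :: "('g, 'b) monoid_scheme" +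
  fixes c :: "'g \<Rightarrow> 'a set"
  assumes one_neq_zero: "\<one> \<noteq> \<zero>"
    and subgroup_c: "g \<in> carrier G \<Longrightarrow> additive_subgroup (c g) S"
    and mult_c: "g \<in> carrier G \<Longrightarrow> h \<in> carrier G \<Longrightarrow> x \<in> c g \<Longrightarrow> y \<in> c h
      \<Longrightarrow> x \<otimes> y \<in> c (g \<otimes>\<^bsub>G\<^esub> h)"
    and span_c: "x \<in> carrier S \<Longrightarrow>
      \<exists>A f. finite A \<and> A \<subseteq> carrier G \<and> (\<forall>g\<in>A. f g \<in> c g) \<and> x = finsum S f A"
    and indep_c: "finite A \<Longrightarrow> A \<subseteq> carrier G \<Longrightarrow> (\<And>g. g \<in> A \<Longrightarrow> f g \<in> c g)
      \<Longrightarrow> finsum S f A = \<zero> \<Longrightarrow> g \<in> A \<Longrightarrow> f g = \<zero>"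
begin

lemma c_carrier: "g \<in> carrier G \<Longrightarrow> x \<in> c g \<Longrightarrow> x \<in> carrier S"
  using additive_subgroup.a_Hcarr[OF subgroup_c] by blast

lemma c_zero: "g \<in> carrier G \<Longrightarrow> \<zero> \<in> c g"
  using additive_subgroup.zero_closed[OF subgroup_c] by blast

lemma c_add: "g \<in> carrier G \<Longrightarrow> x \<in> c g \<Longrightarrow> y \<in> c g \<Longrightarrow> x \<oplus> y \<in> c g"
  using additive_subgroup.a_closed[OF subgroup_c] by blast

lemma c_minus: "g \<in> carrier G \<Longrightarrow> x \<in> c g \<Longrightarrow> \<ominus> x \<in> c g"
  using additive_subgroup.a_inv_closed[OF subgroup_c] by blast

text \<open>Families are total on the group and zero outside some finite \<open>B\<close>. As
  \<open>B\<close> may be enlarged freely, any two families can be compared on a common finite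
  set.\<close>

definition decomp :: "('g \<Rightarrow> 'a) \<Rightarrow> 'a \<Rightarrow> bool" where
  "decomp f x \<longleftrightarrow> (\<forall>g\<in>carrier G. f g \<in> c g) \<and>
     (\<exists>B. finite B \<and> B \<subseteq> carrier G \<and> (\<forall>g\<in>carrier G - B. f g = \<zero>) \<and> x = finsum S f B)"

lemma decomp_superset:
  assumes "\<forall>g\<in>carrier G. f g \<in> c g" "B \<subseteq> C" "finite C" "C \<subseteq> carrier G" "\<forall>g\<in>carrier G - B. f g = \<zero>"
  shows "finsum S f B = finsum S f C"
  by (rule add.finprod_mono_neutral_cong_left) (use assms c_carrier in auto)

lemma decomp_common:
  assumes "decomp f x" "decomp f' x'"
  obtains B where "finite B" "B \<subseteq> carrier G"
    "\<forall>g\<in>carrier G - B. f g = \<zero>" "\<forall>g\<in>carrier G - B. f' g = \<zero>"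
    "x = finsum S f B" "x' = finsum S f' B"
proof -
  obtain B where B: "finite B" "B \<subseteq> carrier G" "\<forall>g\<in>carrier G - B. f g = \<zero>" "x = finsum S f B"
    using assms(1) unfolding decomp_def by blast
  obtain B' where B': "finite B'" "B' \<subseteq> carrier G" "\<forall>g\<in>carrier G - B'. f' g = \<zero>" "x' = finsum S f' B'"
    using assms(2) unfolding decomp_def by blast
  show thesis
  proof (rule that[of "B \<union> B'"])
    show "x = finsum S f (B \<union> B')" "x' = finsum S f' (B \<union> B')"
      using decomp_superset[of f B "B \<union> B'"] decomp_superset[of f' B' "B \<union> B'"] assms B B'
      unfolding decomp_def by auto
  qed (use B B' in auto)
qed

lemma decomp_exists:
  assumes "x \<in> carrier S"
  shows "\<exists>f. decomp f x"
proof -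
  obtain A f where A: "finite A" "A \<subseteq> carrier G" "\<forall>g\<in>A. f g \<in> c g" "x = finsum S f A"
    using span_c[OF assms] by blast
  have "finsum S f A = finsum S (\<lambda>g. if g \<in> A then f g else \<zero>) A"
    by (rule finsum_cong') (use A c_carrier in auto)
  then have "decomp (\<lambda>g. if g \<in> A then f g else \<zero>) x"
    unfolding decomp_def using A c_zero by (auto intro!: exI[of _ A])
  then show ?thesis by blast
qed

text \<open>On a common finite support the difference of the two families is homogeneous with sum
  zero, so independence of the components annihilates each entry.\<close>

lemma decomp_unique:
  assumes "decomp f x" "decomp f' x" "g \<in> carrier G"
  shows "f g = f' g"
proof -
  obtain B where B: "finite B" "B \<subseteq> carrier G" "\<forall>g\<in>carrier G - B. f g = \<zero>"
    "\<forall>g\<in>carrier G - B. f' g = \<zero>" "x = finsum S f B" "x = finsum S f' B"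
    using decomp_common[OF assms(1,2)] by metis
  have f: "\<forall>g\<in>carrier G. f g \<in> c g" "\<forall>g\<in>carrier G. f' g \<in> c g" using assms unfolding decomp_def by auto
  have fc: "f k \<in> carrier S" "f' k \<in> carrier S" if "k \<in> carrier G" for k using f c_carrier that by auto
  have d: "(\<lambda>k. f k \<ominus> f' k) \<in> B \<rightarrow> carrier S" "f' \<in> B \<rightarrow> carrier S" using fc B(2) by auto
  have "finsum S (\<lambda>k. f k \<ominus> f' k) B \<oplus> finsum S f' B = finsum S (\<lambda>k. f k \<ominus> f' k \<oplus> f' k) B"
    using finsum_addf[OF d] by simp
  also have "\<dots> = finsum S f B"
    by (rule finsum_cong') (use fc B in \<open>auto simp: minus_eq a_assoc l_neg\<close>)
  also have "\<dots> = finsum S f' B" using B by simp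
  finally have "finsum S (\<lambda>k. f k \<ominus> f' k) B = \<zero>"
    using finsum_closed[OF d(1)] finsum_closed[OF d(2)] by (metis add.r_cancel_one')
  then have "f k \<ominus> f' k = \<zero>" if "k \<in> B" for k
    using indep_c[OF B(1,2) _ _ that, of "\<lambda>k. f k \<ominus> f' k"] f B(2) c_add c_minus
    by (metis a_minus_def subsetD)
  then have "f k = f' k" if "k \<in> B" for k using that fc B(2) by (metis r_right_minus_eq subsetD)
  then show ?thesis using B assms(3) by (cases "g \<in> B") auto
qed

text \<open>The homogeneous component map. By uniqueness the choice does not affect values at
  elements of the group; outside its carrier the values are arbitrary.\<close>

definition proj :: "'a \<Rightarrow> 'g \<Rightarrow> 'a" where
  "proj x = (SOME f. decomp f x)"

lemma decomp_proj: "x \<in> carrier S \<Longrightarrow> decomp (proj x) x"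
  unfolding proj_def using decomp_exists by (rule someI_ex)

lemma proj_eqI: "decomp f x \<Longrightarrow> x \<in> carrier S \<Longrightarrow> g \<in> carrier G \<Longrightarrow> proj x g = f g"
  using decomp_unique decomp_proj by blast

lemma proj_mem: "x \<in> carrier S \<Longrightarrow> g \<in> carrier G \<Longrightarrow> proj x g \<in> c g"
  using decomp_proj unfolding decomp_def by blast

lemma proj_carrier [simp, intro]: "x \<in> carrier S \<Longrightarrow> g \<in> carrier G \<Longrightarrow> proj x g \<in> carrier S"
  using proj_mem c_carrier by blast

lemma proj_finite:
  assumes "x \<in> carrier S"
  shows "finite {g \<in> carrier G. proj x g \<noteq> \<zero>}"
proof -
  obtain B where B: "finite B" "\<forall>g\<in>carrier G - B. proj x g = \<zero>"
    using decomp_proj[OF assms] unfolding decomp_def by blast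
  then have "{g \<in> carrier G. proj x g \<noteq> \<zero>} \<subseteq> B" by blast
  then show ?thesis using B finite_subset by blast
qed

section \<open>Components of sums, differences and products with homogeneous factors\<close>

lemma proj_add:
  assumes "x \<in> carrier S" "y \<in> carrier S" "g \<in> carrier G"
  shows "proj (x \<oplus> y) g = proj x g \<oplus> proj y g"
proof -
  obtain B where B: "finite B" "B \<subseteq> carrier G" "\<forall>g\<in>carrier G - B. proj x g = \<zero>"
    "\<forall>g\<in>carrier G - B. proj y g = \<zero>" "x = finsum S (proj x) B" "y = finsum S (proj y) B"
    using decomp_common[OF decomp_proj decomp_proj] assms by metis
  have "x \<oplus> y = finsum S (\<lambda>k. proj x k \<oplus> proj y k) B"
    using finsum_addf[of "proj x" B "proj y"] B(2,5,6) assms proj_carrier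
    by (metis (no_types, lifting) Pi_I subsetD)
  then have "decomp (\<lambda>k. proj x k \<oplus> proj y k) (x \<oplus> y)"
    unfolding decomp_def using B assms c_add proj_mem by (auto intro!: exI[of _ B])
  then show ?thesis using proj_eqI assms by simp
qed

lemma proj_homogeneous:
  assumes "h \<in> carrier G" "x \<in> c h" "g \<in> carrier G"
  shows "proj x g = (if g = h then x else \<zero>)"
proof -
  have x: "x \<in> carrier S" using assms c_carrier by blast
  have "finsum S (\<lambda>g. if g = h then x else \<zero>) {h} = x"
    using x by (subst finsum_insert) auto
  then have "decomp (\<lambda>g. if g = h then x else \<zero>) x"
    unfolding decomp_def using assms c_zero by (auto intro!: exI[of _ "{h}"])
  from proj_eqI[OF this x assms(3)] show ?thesis .
qed

lemma proj_zero [simp]: "g \<in> carrier G \<Longrightarrow> proj \<zero> g = \<zero>"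
  using proj_homogeneous[of g \<zero> g] c_zero by simp

lemma proj_uminus:
  assumes "x \<in> carrier S" "g \<in> carrier G"
  shows "proj (\<ominus> x) g = \<ominus> proj x g"
proof -
  have "proj (\<ominus> x) g \<oplus> proj x g = \<zero>"
    using proj_add[of "\<ominus> x" x g] assms by (simp add: l_neg)
  then show ?thesis using assms by (metis a_inv_closed proj_carrier minus_equality)
qed

lemma proj_minus:
  "x \<in> carrier S \<Longrightarrow> y \<in> carrier S \<Longrightarrow> g \<in> carrier G \<Longrightarrow> proj (x \<ominus> y) g = proj x g \<ominus> proj y g"
  by (simp add: minus_eq proj_add proj_uminus)

lemma proj_zeroD:
  assumes "x \<in> carrier S" "\<And>g. g \<in> carrier G \<Longrightarrow> proj x g = \<zero>"
  shows "x = \<zero>"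
proof -
  obtain B where "finite B" "B \<subseteq> carrier G" "x = finsum S (proj x) B"
    using decomp_proj[OF assms(1)] unfolding decomp_def by blast
  moreover have "finsum S (proj x) B = \<zero>"
    by (rule add.finprod_one_eqI) (use assms(2) calculation in auto)
  ultimately show ?thesis by simp
qed

lemma proj_eq_ext:
  assumes "x \<in> carrier S" "y \<in> carrier S" "\<And>g. g \<in> carrier G \<Longrightarrow> proj x g = proj y g"
  shows "x = y"
proof -
  have "x \<ominus> y = \<zero>" by (rule proj_zeroD) (use assms in \<open>auto simp: proj_minus\<close>)
  then show ?thesis using assms by simp
qed

text \<open>Multiplying by \<open>y\<close> of degree \<open>h\<close> translates degrees by
  \<open>h\<close>: the translated family of products is a decomposition of \<open>x y\<close>, and
  decompositions are unique.\<close>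

lemma proj_mult_right:
  assumes x: "x \<in> carrier S" and h: "h \<in> carrier G" and y: "y \<in> c h" and g: "g \<in> carrier G"
  shows "proj (x \<otimes> y) g = proj x (g \<otimes>\<^bsub>G\<^esub> inv\<^bsub>G\<^esub> h) \<otimes> y"
proof -
  let ?f = "\<lambda>g. proj x (g \<otimes>\<^bsub>G\<^esub> inv\<^bsub>G\<^esub> h) \<otimes> y"
  have yS: "y \<in> carrier S" using y h c_carrier by blast
  obtain B where B: "finite B" "B \<subseteq> carrier G" "\<forall>g\<in>carrier G - B. proj x g = \<zero>" "x = finsum S (proj x) B"
    using decomp_proj[OF x] unfolding decomp_def by blast
  have projB: "proj x \<in> B \<rightarrow> carrier S" using B(2) x by auto
  let ?m = "\<lambda>k. k \<otimes>\<^bsub>G\<^esub> h"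
  have inj: "inj_on ?m B" using B h by (intro inj_onI) (metis G.right_cancel subsetD)
  have shift_back: "k \<otimes>\<^bsub>G\<^esub> h \<otimes>\<^bsub>G\<^esub> inv\<^bsub>G\<^esub> h = k" if "k \<in> carrier G" for k
    using that h by (simp add: G.m_assoc)
  have shift_forth: "k \<otimes>\<^bsub>G\<^esub> inv\<^bsub>G\<^esub> h \<otimes>\<^bsub>G\<^esub> h = k" if "k \<in> carrier G" for k
    using that h by (simp add: G.m_assoc)
  have "finsum S ?f (?m ` B) = finsum S (\<lambda>k. ?f (?m k)) B"
    by (rule finsum_reindex) (use inj B h x yS in auto)
  also have "\<dots> = finsum S (\<lambda>k. proj x k \<otimes> y) B"
    by (rule finsum_cong') (use B shift_back x yS in auto)
  also have "\<dots> = x \<otimes> y"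
    using finsum_ldistr[OF B(1) yS projB] unfolding B(4)[symmetric] by simp
  finally have "x \<otimes> y = finsum S ?f (?m ` B)" by simp
  moreover have "?f k \<in> c k" if "k \<in> carrier G" for k
    using mult_c[OF _ h proj_mem[OF x] y, of "k \<otimes>\<^bsub>G\<^esub> inv\<^bsub>G\<^esub> h"] that h by (simp add: shift_forth)
  moreover have "?f k = \<zero>" if "k \<in> carrier G - ?m ` B" for k
  proof -
    have "k \<otimes>\<^bsub>G\<^esub> inv\<^bsub>G\<^esub> h \<notin> B"
      using that shift_forth by (metis DiffE image_eqI)
    then show ?thesis using B(3) that h yS by simp
  qed
  ultimately have "decomp ?f (x \<otimes> y)"
    unfolding decomp_def using B h by (intro conjI ballI exI[of _ "?m ` B"]) auto
  then show ?thesis using proj_eqI g x yS by simp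
qed

lemma proj_mult_left:
  assumes x: "x \<in> carrier S" and h: "h \<in> carrier G" and y: "y \<in> c h" and g: "g \<in> carrier G"
  shows "proj (y \<otimes> x) g = y \<otimes> proj x (inv\<^bsub>G\<^esub> h \<otimes>\<^bsub>G\<^esub> g)"
proof -
  let ?f = "\<lambda>g. y \<otimes> proj x (inv\<^bsub>G\<^esub> h \<otimes>\<^bsub>G\<^esub> g)"
  have yS: "y \<in> carrier S" using y h c_carrier by blast
  obtain B where B: "finite B" "B \<subseteq> carrier G" "\<forall>g\<in>carrier G - B. proj x g = \<zero>" "x = finsum S (proj x) B"
    using decomp_proj[OF x] unfolding decomp_def by blast
  have projB: "proj x \<in> B \<rightarrow> carrier S" using B(2) x by auto
  let ?m = "\<lambda>k. h \<otimes>\<^bsub>G\<^esub> k"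
  have inj: "inj_on ?m B" using B h by (intro inj_onI) (metis G.l_cancel subsetD)
  have shift_back: "inv\<^bsub>G\<^esub> h \<otimes>\<^bsub>G\<^esub> (h \<otimes>\<^bsub>G\<^esub> k) = k" if "k \<in> carrier G" for k
    using that h by (simp add: G.m_assoc[symmetric])
  have shift_forth: "h \<otimes>\<^bsub>G\<^esub> (inv\<^bsub>G\<^esub> h \<otimes>\<^bsub>G\<^esub> k) = k" if "k \<in> carrier G" for k
    using that h by (simp add: G.m_assoc[symmetric])
  have "finsum S ?f (?m ` B) = finsum S (\<lambda>k. ?f (?m k)) B"
    by (rule finsum_reindex) (use inj B h x yS in auto)
  also have "\<dots> = finsum S (\<lambda>k. y \<otimes> proj x k) B"
    by (rule finsum_cong') (use B shift_back x yS in auto)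
  also have "\<dots> = y \<otimes> x"
    using finsum_rdistr[OF B(1) yS projB] unfolding B(4)[symmetric] by simp
  finally have "y \<otimes> x = finsum S ?f (?m ` B)" by simp
  moreover have "?f k \<in> c k" if "k \<in> carrier G" for k
    using mult_c[OF h _ y proj_mem[OF x], of "inv\<^bsub>G\<^esub> h \<otimes>\<^bsub>G\<^esub> k"] that h by (simp add: shift_forth)
  moreover have "?f k = \<zero>" if "k \<in> carrier G - ?m ` B" for k
  proof -
    have "inv\<^bsub>G\<^esub> h \<otimes>\<^bsub>G\<^esub> k \<notin> B"
      using that shift_forth by (metis DiffE image_eqI)
    then show ?thesis using B(3) that h yS by simp
  qed
  ultimately have "decomp ?f (y \<otimes> x)"
    unfolding decomp_def using B h by (intro conjI ballI exI[of _ "?m ` B"]) auto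
  then show ?thesis using proj_eqI g x yS by simp
qed

text \<open>Let \<open>u\<close> be the degree-\<open>e\<close> component of \<open>1\<close>.
  Comparing components in \<open>x 1 = x\<close> gives \<open>x u = x\<close> for homogeneous
  \<open>x\<close>, hence for all \<open>x\<close>; the case \<open>x = 1\<close> yields
  \<open>u = 1\<close>.\<close>

lemma one_mem: "\<one> \<in> c \<one>\<^bsub>G\<^esub>"
proof -
  let ?u = "proj \<one> \<one>\<^bsub>G\<^esub>"
  have u: "?u \<in> c \<one>\<^bsub>G\<^esub>" by (rule proj_mem) auto
  have uS: "?u \<in> carrier S" using u c_carrier by blast
  have hom: "x \<otimes> ?u = x" if "g \<in> carrier G" "x \<in> c g" for g x
    using proj_mult_left[OF one_closed that that(1)] proj_homogeneous[OF that that(1)] that c_carrier[OF that]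
    by simp
  have "x \<otimes> ?u = x" if "x \<in> carrier S" for x
  proof (rule proj_eq_ext)
    fix g assume g: "g \<in> carrier G"
    have "proj (x \<otimes> ?u) g = proj x g \<otimes> ?u"
      using proj_mult_right[OF that _ u g] g by simp
    then show "proj (x \<otimes> ?u) g = proj x g" using hom g proj_mem that by simp
  qed (use that uS in auto)
  from this[of \<one>] uS have "?u = \<one>" by simp
  then show ?thesis using u by simp
qed

end

section \<open>Nilpotency of homogeneous elements\<close>

lemma (in ring) left_ideal_iff:
  "left_ideal I R \<longleftrightarrow> I \<subseteq> carrier R \<and> \<zero> \<in> I \<and> (\<forall>x\<in>I. \<forall>y\<in>I. x \<oplus> y \<in> I)
     \<and> (\<forall>r\<in>carrier R. \<forall>x\<in>I. r \<otimes> x \<in> I)" (is "?l \<longleftrightarrow> ?r")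
proof
  assume ?l
  then have "additive_subgroup I R" unfolding left_ideal_def by blast
  then interpret additive_subgroup I R .
  show ?r using \<open>?l\<close> a_subset unfolding left_ideal_def by auto
next
  assume r: ?r
  have "\<ominus> x \<in> I" if "x \<in> I" for x
  proof -
    have "\<ominus> x = (\<ominus> \<one>) \<otimes> x" using that r by (auto simp: l_minus)
    then show ?thesis using that r by simp
  qed
  then show ?l unfolding left_ideal_def using r by (auto intro!: additive_subgroupI')
qed

lemma (in group) infinite_order_inj:
  assumes "h \<in> carrier G" "\<And>n::nat. n > 0 \<Longrightarrow> h [^] n \<noteq> \<one>"
  shows "inj (\<lambda>n::nat. h [^] n)"
proof -
  have "h [^] m \<noteq> h [^] n" if "m < n" for m n :: nat
  proof
    assume "h [^] m = h [^] n"
    moreover have "h [^] m \<otimes> h [^] (n - m) = h [^] n"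
      using that assms(1) by (simp add: nat_pow_mult)
    ultimately have "h [^] m \<otimes> h [^] (n - m) = h [^] m \<otimes> \<one>" using assms(1) by simp
    then show False using assms that by (metis l_cancel nat_pow_closed one_closed zero_less_diff)
  qed
  then show ?thesis by (intro injI) (metis linorder_neqE_nat)
qed

context graded
begin

abbreviation principal :: "('a, 'c) ring_scheme" where
  "principal \<equiv> S\<lparr>carrier := c \<one>\<^bsub>G\<^esub>\<rparr>"

lemma c_one_mult: "g \<in> carrier G \<Longrightarrow> r \<in> c \<one>\<^bsub>G\<^esub> \<Longrightarrow> x \<in> c g \<Longrightarrow> r \<otimes> x \<in> c g"
  using mult_c[of "\<one>\<^bsub>G\<^esub>" g r x] by simp

lemma c_mult_one: "g \<in> carrier G \<Longrightarrow> x \<in> c g \<Longrightarrow> r \<in> c \<one>\<^bsub>G\<^esub> \<Longrightarrow> x \<otimes> r \<in> c g"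
  using mult_c[of g "\<one>\<^bsub>G\<^esub>" x r] by simp

lemma c_one_carrier: "r \<in> c \<one>\<^bsub>G\<^esub> \<Longrightarrow> r \<in> carrier S"
  using c_carrier by blast

lemma ring_principal: "ring principal"
proof (rule subring_is_ring, rule subringI)
  show "c \<one>\<^bsub>G\<^esub> \<subseteq> carrier S" using c_carrier by blast
qed (use one_mem c_minus c_add c_one_mult in auto)

lemma left_ideal_principal_iff:
  "left_ideal I principal \<longleftrightarrow> I \<subseteq> c \<one>\<^bsub>G\<^esub> \<and> \<zero> \<in> I \<and> (\<forall>x\<in>I. \<forall>y\<in>I. x \<oplus> y \<in> I)
     \<and> (\<forall>r\<in>c \<one>\<^bsub>G\<^esub>. \<forall>x\<in>I. r \<otimes> x \<in> I)"
  using ring.left_ideal_iff[OF ring_principal] by simp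

text \<open>A left ideal \<open>I\<close> of \<open>S\<^sub>e\<close> is recovered as the degree-\<open>e\<close> part of the largest left ideal of \<open>S\<close>
  whose degree-\<open>e\<close> projection lies in \<open>I\<close>.\<close>

lemma left_artinian_principal:
  assumes "left_artinian S"
  shows "left_artinian principal"
  unfolding left_artinian_def
proof (intro allI impI)
  fix I :: "nat \<Rightarrow> 'a set"
  assume I: "(\<forall>n. left_ideal (I n) principal) \<and> (\<forall>n. I (Suc n) \<subseteq> I n)"
  define E where "E J = {x \<in> carrier S. \<forall>y\<in>carrier S. proj (y \<otimes> x) \<one>\<^bsub>G\<^esub> \<in> J}" for J
  have id: "left_ideal (E (I n)) S" for n
  proof -
    have "left_ideal (I n) principal" using I by blast
    then have l: "\<zero> \<in> I n" "\<And>x y. x \<in> I n \<Longrightarrow> y \<in> I n \<Longrightarrow> x \<oplus> y \<in> I n"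
      unfolding left_ideal_principal_iff by auto
    show ?thesis
      unfolding left_ideal_iff E_def using l by (auto simp: proj_add r_distr m_assoc[symmetric])
  qed
  have "E (I (Suc n)) \<subseteq> E (I n)" for n using I unfolding E_def by blast
  then obtain N where N: "\<forall>n\<ge>N. E (I n) = E (I N)"
    using assms[unfolded left_artinian_def, rule_format, of "\<lambda>n. E (I n)"] id by blast
  have rec: "I n = E (I n) \<inter> c \<one>\<^bsub>G\<^esub>" for n
  proof -
    have "left_ideal (I n) principal" using I by blast
    then have l: "I n \<subseteq> c \<one>\<^bsub>G\<^esub>" "\<And>r x. r \<in> c \<one>\<^bsub>G\<^esub> \<Longrightarrow> x \<in> I n \<Longrightarrow> r \<otimes> x \<in> I n"
      unfolding left_ideal_principal_iff by auto
    \<comment> \<open>This formula puts \<open>I n\<close> inside \<open>E (I n)\<close>, because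
      \<open>I n\<close> absorbs left factors of degree \<open>e\<close>. The converse takes
      \<open>y = 1\<close>.\<close>
    have p: "proj (y \<otimes> x) \<one>\<^bsub>G\<^esub> = proj y \<one>\<^bsub>G\<^esub> \<otimes> x" if "y \<in> carrier S" "x \<in> c \<one>\<^bsub>G\<^esub>" for x y
      using proj_mult_right[OF that(1) _ that(2)] by simp
    have "x \<in> E (I n)" if "x \<in> I n" for x
      unfolding E_def using that l p proj_mem c_one_carrier by auto
    moreover have "x \<in> I n" if "x \<in> E (I n)" "x \<in> c \<one>\<^bsub>G\<^esub>" for x
    proof -
      have "proj (\<one> \<otimes> x) \<one>\<^bsub>G\<^esub> \<in> I n" using that unfolding E_def by blast
      then show ?thesis using that c_one_carrier proj_homogeneous[of "\<one>\<^bsub>G\<^esub>" x "\<one>\<^bsub>G\<^esub>"] by simp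
    qed
    ultimately show ?thesis using l by blast
  qed
  show "\<exists>N. \<forall>n\<ge>N. I n = I N" using N rec by metis
qed

text \<open>The translates of \<open>k\<close> by powers of an element of infinite order are
  pairwise distinct, whereas an element of \<open>S\<close> has finite support.\<close>

lemma proj_vanish:
  assumes "z \<in> carrier S" "k \<in> carrier G" "h \<in> carrier G" "\<And>n::nat. n > 0 \<Longrightarrow> h [^]\<^bsub>G\<^esub> n \<noteq> \<one>\<^bsub>G\<^esub>"
  shows "\<exists>n::nat. proj z (k \<otimes>\<^bsub>G\<^esub> h [^]\<^bsub>G\<^esub> n) = \<zero>"
proof (rule ccontr)
  assume "\<not> ?thesis"
  then have "range (\<lambda>n::nat. k \<otimes>\<^bsub>G\<^esub> h [^]\<^bsub>G\<^esub> n) \<subseteq> {g \<in> carrier G. proj z g \<noteq> \<zero>}" using assms by auto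
  then have "finite (range (\<lambda>n::nat. k \<otimes>\<^bsub>G\<^esub> h [^]\<^bsub>G\<^esub> n))" using proj_finite[OF assms(1)] finite_subset by blast
  moreover have "inj (\<lambda>n::nat. k \<otimes>\<^bsub>G\<^esub> h [^]\<^bsub>G\<^esub> n)"
    using G.infinite_order_inj[OF assms(3,4)] assms by (auto simp: inj_def)
  ultimately show False using finite_imageD by blast
qed

text \<open>A left inverse of \<open>\<one> \<ominus> x\<close> would have to be the geometric series in \<open>x\<close>, which is a finite sum
  only if \<open>x\<close> is nilpotent.\<close>

lemma homogeneous_nilp:
  assumes art: "left_artinian S" and g: "g \<in> carrier G" "\<And>n::nat. n > 0 \<Longrightarrow> g [^]\<^bsub>G\<^esub> n \<noteq> \<one>\<^bsub>G\<^esub>"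
    and x: "x \<in> c g"
  shows "nilp x"
proof -
  have xS: "x \<in> carrier S" using x g c_carrier by blast
  let ?i = "inv\<^bsub>G\<^esub> g"
  have iord: "?i [^]\<^bsub>G\<^esub> n \<noteq> \<one>\<^bsub>G\<^esub>" if "n > 0" for n :: nat
    using g(2)[OF that] g(1) by (metis G.inv_eq_1_iff G.nat_pow_closed G.nat_pow_inv)
  have shift: "proj (y \<otimes> (\<one> \<ominus> x)) k = proj y k \<ominus> proj y (k \<otimes>\<^bsub>G\<^esub> ?i) \<otimes> x"
    if "y \<in> carrier S" "k \<in> carrier G" for y k
    using that xS proj_mult_right[OF that(1) g(1) x that(2)]
    by (simp add: r_distr r_minus proj_add proj_uminus minus_eq)
  \<comment> \<open>Following the recursion back along \<open>k\<close>, \<open>k g^-1\<close>,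
    \<open>k g^-2\<close> and so on expresses the component at \<open>k\<close> through ever more
    distant ones, one of which is zero.\<close>
  have iter: "proj y k = \<zero>"
    if y: "y \<in> carrier S" and k: "k \<in> carrier G"
      and eq: "\<And>m::nat. proj y (k \<otimes>\<^bsub>G\<^esub> ?i [^]\<^bsub>G\<^esub> m) = proj y (k \<otimes>\<^bsub>G\<^esub> ?i [^]\<^bsub>G\<^esub> m \<otimes>\<^bsub>G\<^esub> ?i) \<otimes> x" for y k
  proof -
    have "proj y k = proj y (k \<otimes>\<^bsub>G\<^esub> ?i [^]\<^bsub>G\<^esub> n) \<otimes> x [^] n" for n :: nat
    proof (induction n)
      case 0 then show ?case using y k by simp
    next
      case (Suc n)
      have "proj y k = proj y (k \<otimes>\<^bsub>G\<^esub> ?i [^]\<^bsub>G\<^esub> n \<otimes>\<^bsub>G\<^esub> ?i) \<otimes> x \<otimes> x [^] n" using Suc eq by metis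
      also have "\<dots> = proj y (k \<otimes>\<^bsub>G\<^esub> ?i [^]\<^bsub>G\<^esub> Suc n) \<otimes> x [^] Suc n"
        using y k g xS by (simp add: m_assoc G.m_assoc nat_pow_Suc2[symmetric])
      finally show ?case .
    qed
    then show ?thesis using proj_vanish[OF y k G.inv_closed[OF g(1)] iord] xS by (metis l_null nat_pow_closed)
  qed
  \<comment> \<open>So \<open>1 - x\<close> may be cancelled on the right. Cancelling its powers
    from the stable relation \<open>(1 - x)^n = t (1 - x)^(n+1)\<close> leaves
    \<open>t (1 - x) = 1\<close>.\<close>
  have regular: "y = \<zero>" if y: "y \<in> carrier S" "y \<otimes> (\<one> \<ominus> x) = \<zero>" for y
  proof (rule proj_zeroD[OF y(1)])
    fix k assume k: "k \<in> carrier G"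
    show "proj y k = \<zero>"
    proof (rule iter[OF y(1) k])
      fix m :: nat
      show "proj y (k \<otimes>\<^bsub>G\<^esub> ?i [^]\<^bsub>G\<^esub> m) = proj y (k \<otimes>\<^bsub>G\<^esub> ?i [^]\<^bsub>G\<^esub> m \<otimes>\<^bsub>G\<^esub> ?i) \<otimes> x"
        (is "?p = ?q")
      proof -
        have "?p \<ominus> ?q = \<zero>"
          using shift[OF y(1), of "k \<otimes>\<^bsub>G\<^esub> ?i [^]\<^bsub>G\<^esub> m"] k g(1) unfolding y(2) by simp
        then show ?thesis using y(1) k g(1) xS by simp
      qed
    qed
  qed
  obtain n t where t: "t \<in> carrier S" "(\<one> \<ominus> x) [^] n = t \<otimes> (\<one> \<ominus> x) [^] Suc n"
    using left_artinian_power_stable[OF art, of "\<one> \<ominus> x"] xS by auto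
  have reg_pow: "y = \<zero>" if "y \<in> carrier S" "y \<otimes> (\<one> \<ominus> x) [^] n = \<zero>" for y and n :: nat
    using that
  proof (induction n arbitrary: y)
    case (Suc n)
    then have "(y \<otimes> (\<one> \<ominus> x) [^] n) \<otimes> (\<one> \<ominus> x) = \<zero>" using xS by (simp add: m_assoc)
    then have "y \<otimes> (\<one> \<ominus> x) [^] n = \<zero>" by (rule regular[rotated]) (use Suc.prems(1) xS in auto)
    then show ?case by (rule Suc.IH[OF Suc.prems(1)])
  qed simp
  have "(\<one> \<ominus> t \<otimes> (\<one> \<ominus> x)) \<otimes> (\<one> \<ominus> x) [^] n = (\<one> \<ominus> x) [^] n \<ominus> t \<otimes> (\<one> \<ominus> x) [^] Suc n"
    using t(1) xS by (simp add: minus_eq[of _ "t \<otimes> _"] l_distr l_minus m_assoc nat_pow_Suc2[symmetric])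
  also have "\<dots> = \<zero>" using t xS by (metis m_closed minus_closed nat_pow_closed one_closed r_right_minus_eq)
  finally have "\<one> \<ominus> t \<otimes> (\<one> \<ominus> x) = \<zero>" using reg_pow t(1) xS by simp
  then have t1: "t \<otimes> (\<one> \<ominus> x) = \<one>" using t(1) xS by (metis m_closed minus_closed one_closed r_right_minus_eq)
  have rec: "proj t k = proj \<one> k \<oplus> proj t (k \<otimes>\<^bsub>G\<^esub> ?i) \<otimes> x" if k: "k \<in> carrier G" for k
  proof -
    have "proj \<one> k = proj t k \<ominus> proj t (k \<otimes>\<^bsub>G\<^esub> ?i) \<otimes> x" using shift[OF t(1) k] t1 by simp
    then show ?thesis using t(1) k g xS by (simp add: minus_eq a_assoc l_neg)
  qed
  have p1: "proj \<one> k = (if k = \<one>\<^bsub>G\<^esub> then \<one> else \<zero>)" if "k \<in> carrier G" for k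
    using proj_homogeneous[OF _ one_mem that] by simp
  \<comment> \<open>The degrees \<open>g^-1\<close>, \<open>g^-2\<close>, ... avoid the neutral
    element, so the term coming from \<open>1\<close> never enters the recursion. This starts the
    series: the component of \<open>t\<close> at the neutral element is \<open>1\<close>.\<close>
  have neg: "proj t ?i = \<zero>"
  proof (rule iter[OF t(1)])
    fix m :: nat
    have "?i \<otimes>\<^bsub>G\<^esub> ?i [^]\<^bsub>G\<^esub> m \<noteq> \<one>\<^bsub>G\<^esub>" using iord[of "Suc m"] g(1) by (metis G.inv_closed G.nat_pow_Suc2 zero_less_Suc)
    then show "proj t (?i \<otimes>\<^bsub>G\<^esub> ?i [^]\<^bsub>G\<^esub> m) = proj t (?i \<otimes>\<^bsub>G\<^esub> ?i [^]\<^bsub>G\<^esub> m \<otimes>\<^bsub>G\<^esub> ?i) \<otimes> x"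
      using rec[of "?i \<otimes>\<^bsub>G\<^esub> ?i [^]\<^bsub>G\<^esub> m"] p1[of "?i \<otimes>\<^bsub>G\<^esub> ?i [^]\<^bsub>G\<^esub> m"] g(1) t(1) xS by simp
  qed (use g in simp)
  \<comment> \<open>Here \<open>t\<close> is identified with the geometric series along the powers
    of \<open>g\<close>; a vanishing component is a vanishing power of \<open>x\<close>.\<close>
  have "proj t (g [^]\<^bsub>G\<^esub> n) = x [^] n" for n :: nat
  proof (induction n)
    case 0 then show ?case using rec[of "\<one>\<^bsub>G\<^esub>"] neg p1[of "\<one>\<^bsub>G\<^esub>"] g xS by simp
  next
    case (Suc n)
    have "g [^]\<^bsub>G\<^esub> Suc n \<otimes>\<^bsub>G\<^esub> ?i = g [^]\<^bsub>G\<^esub> n" using g(1) by (simp add: G.m_assoc)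
    moreover have "proj \<one> (g [^]\<^bsub>G\<^esub> Suc n) = \<zero>" using p1 g by (metis G.nat_pow_closed zero_less_Suc)
    ultimately show ?case
      using rec[of "g [^]\<^bsub>G\<^esub> Suc n"] Suc g(1) xS by (simp del: G.nat_pow_Suc Group.nat_pow_Suc)
  qed
  moreover obtain m :: nat where "proj t (\<one>\<^bsub>G\<^esub> \<otimes>\<^bsub>G\<^esub> g [^]\<^bsub>G\<^esub> m) = \<zero>"
    using proj_vanish[OF t(1) _ g] by blast
  ultimately show ?thesis unfolding nilp_def using g(1) by (metis G.l_one G.nat_pow_closed)
qed

end

section \<open>Finiteness of the support\<close>

context graded
begin

text \<open>The local units are asked for on the right and inside \<open>S_(g^-1) S_g\<close>, a
  form that the grading and its opposite can both supply.\<close>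

lemma finite_support_if_left_artinian:
  assumes art: "left_artinian S" and tf: "torsion_free_group G"
    and unit: "\<And>g. g \<in> carrier G \<Longrightarrow> \<exists>\<epsilon>\<in>ring_setmult S (c (inv\<^bsub>G\<^esub> g)) (c g). \<forall>x\<in>c g. x \<otimes> \<epsilon> = x"
  shows "finite {g \<in> carrier G. c g \<noteq> {\<zero>}}"
proof (rule ccontr)
  assume inf: "\<not> finite {g \<in> carrier G. c g \<noteq> {\<zero>}}"
  note artR = left_artinian_principal[OF art]
  interpret R: ring principal by (rule ring_principal)
  have Rnilp: "R.nilp a = nilp a" for a unfolding R.nilp_def nilp_def by (simp add: nat_pow_def)
  have Rcorner: "R.corner e = {x \<in> c \<one>\<^bsub>G\<^esub>. e \<otimes> x = x \<and> x \<otimes> e = x}" for e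
    unfolding R.corner_def by simp
  let ?R = "c \<one>\<^bsub>G\<^esub>"
  have RS: "x \<in> carrier S" if "x \<in> ?R" for x using that c_one_carrier by blast
  have Rm: "x \<otimes> y \<in> ?R" if "x \<in> ?R" "y \<in> ?R" for x y using that c_one_mult by simp
  \<comment> \<open>\<open>A e\<close> is the set of degrees with \<open>S_g e\<close> nonzero, so
    \<open>A 1\<close> is the support. The idempotent \<open>e\<close> chosen below, with
    \<open>R e\<close> minimal and \<open>A e\<close> infinite, is the \<open>f\<close> of the
    overview.\<close>
  define A where "A e = {g \<in> carrier G. \<exists>x\<in>c g. x \<otimes> e \<noteq> \<zero>}" for e
  define L where "L e = (\<lambda>r. r \<otimes> e) ` ?R" for e
  define Q where "Q e \<longleftrightarrow> e \<in> ?R \<and> e \<otimes> e = e \<and> infinite (A e)" for e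
  have "A \<one> = {g \<in> carrier G. c g \<noteq> {\<zero>}}"
    unfolding A_def using c_carrier c_zero by fastforce
  then have "Q \<one>" unfolding Q_def using inf one_mem by simp
  then have "L ` {e. Q e} \<noteq> {}" by blast
  moreover have "left_ideal I principal" if "I \<in> L ` {e. Q e}" for I
    using that R.left_ideal_principal unfolding L_def Q_def by auto
  ultimately obtain I where I: "I \<in> L ` {e. Q e}" "\<forall>J\<in>L ` {e. Q e}. J \<subseteq> I \<longrightarrow> J = I"
    using left_artinian_minimal[OF artR, of "L ` {e. Q e}"] by blast
  then obtain e where e: "e \<in> ?R" "e \<otimes> e = e" "infinite (A e)" and Ie: "I = L e" unfolding Q_def by blast
  have eS: "e \<in> carrier S" using RS e by blast
  have e0: "e \<noteq> \<zero>"
  proof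
    assume "e = \<zero>"
    then have "A e = {}" unfolding A_def using c_carrier by auto
    then show False using e by simp
  qed
  \<comment> \<open>Minimality forces \<open>R f = R e\<close>, say \<open>e = r f\<close>. Then
    \<open>e f = e\<close>, while \<open>e f = f\<close> holds in the corner.\<close>
  have full: "f = e" if f: "f \<in> R.corner e" "f \<otimes> f = f" "infinite (A f)" for f
  proof -
    have fR: "f \<in> ?R" "e \<otimes> f = f" "f \<otimes> e = f" using f(1) Rcorner by auto
    have "L f \<subseteq> L e"
    proof
      fix x assume "x \<in> L f"
      then obtain r where r: "r \<in> ?R" "x = r \<otimes> f" unfolding L_def by blast
      then have "x = (r \<otimes> f) \<otimes> e" using fR RS eS by (simp add: m_assoc)
      then show "x \<in> L e" unfolding L_def using r fR Rm by blast
    qed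
    moreover have "L f \<in> L ` {e. Q e}" using f fR unfolding Q_def by blast
    ultimately have "L f = L e" using I(2) Ie by blast
    moreover have "e \<in> L e" unfolding L_def using e by (metis image_eqI)
    ultimately obtain r where r: "r \<in> ?R" "e = r \<otimes> f" unfolding L_def by blast
    have "e \<otimes> f = r \<otimes> (f \<otimes> f)" using r fR RS by (simp add: m_assoc)
    then show ?thesis using r f fR by simp
  qed
  \<comment> \<open>From \<open>e = f + (e - f)\<close> every degree in \<open>A e\<close> belongs
    to one of the two summands. One of these idempotents thus has infinitely many degrees and equals
    \<open>e\<close>.\<close>
  have prim: "f = \<zero> \<or> f = e" if f: "f \<in> R.corner e" "f \<otimes> f = f" for f
  proof -
    have fR: "f \<in> ?R" "e \<otimes> f = f" "f \<otimes> e = f" using f(1) Rcorner by auto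
    have fS: "f \<in> carrier S" using RS fR by blast
    have dS: "e \<ominus> f \<in> ?R" using fR e c_add c_minus by (simp add: minus_eq)
    have dc: "e \<ominus> f \<in> R.corner e"
      unfolding Rcorner using dS fR e eS fS by (simp add: minus_eq l_distr r_distr l_minus r_minus)
    have di: "(e \<ominus> f) \<otimes> (e \<ominus> f) = e \<ominus> f"
      using f fR e eS fS by (simp add: minus_eq l_distr r_distr l_minus r_minus r_neg minus_add)
    have "A e \<subseteq> A f \<union> A (e \<ominus> f)"
    proof
      fix g assume "g \<in> A e"
      then obtain x where x: "g \<in> carrier G" "x \<in> c g" "x \<otimes> e \<noteq> \<zero>" unfolding A_def by blast
      have xS: "x \<in> carrier S" using x c_carrier by blast
      have "x \<otimes> e = x \<otimes> f \<oplus> x \<otimes> (e \<ominus> f)"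
        using xS eS fS by (simp add: minus_eq r_distr r_minus a_lcomm r_neg)
      then have "x \<otimes> f \<noteq> \<zero> \<or> x \<otimes> (e \<ominus> f) \<noteq> \<zero>" using x by auto
      then show "g \<in> A f \<union> A (e \<ominus> f)" unfolding A_def using x by blast
    qed
    then have "infinite (A f) \<or> infinite (A (e \<ominus> f))" using e(3) finite_subset by blast
    then have "f = e \<or> e \<ominus> f = e" using full f dc di by blast
    moreover have "f = \<zero>" if "e \<ominus> f = e"
    proof -
      have "e \<oplus> \<ominus> f = e \<oplus> \<zero>" using that eS by (simp add: minus_eq)
      then have "\<ominus> f = \<zero>" using add.l_cancel[of "\<ominus> f" \<zero> e] eS fS by auto
      then show ?thesis using fS by (metis minus_minus minus_zero)
    qed
    ultimately show ?thesis by blast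
  qed
  have left_inv: "\<exists>t. t \<in> ?R \<and> e \<otimes> t = t \<and> t \<otimes> a = e"
    if "a \<in> ?R" "e \<otimes> a = a" "a \<otimes> e = a" "\<not> nilp a" for a
    using R.primitive_idempotent_corner_left_inverse[OF artR, of e a] e prim that
    by (auto simp: Rnilp Rcorner)
  have nilp_add: "nilp (a \<oplus> b)"
    if "a \<in> ?R" "e \<otimes> a = a" "a \<otimes> e = a" "nilp a" "b \<in> ?R" "e \<otimes> b = b" "b \<otimes> e = b" "nilp b" for a b
    using R.primitive_idempotent_corner_nilp_add[OF artR, of e a b] e e0 prim that
    by (auto simp: Rnilp Rcorner)
  have nilp_zero: "nilp \<zero>" unfolding nilp_def by (rule exI[of _ 1]) simp
  \<comment> \<open>If every \<open>e v u e\<close> were nilpotent, locality of the corner would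
    make \<open>e z e\<close> nilpotent for all \<open>z\<close> in \<open>S_(g^-1) S_g\<close>, in
    particular for the local unit. Some \<open>e v u e\<close> is therefore invertible from the left
    in the corner.\<close>
  have split: "\<exists>u v. u \<in> c g \<and> v \<in> c (inv\<^bsub>G\<^esub> g) \<and> u \<otimes> e = u \<and> e \<otimes> v = v \<and> v \<otimes> u = e"
    if gA: "g \<in> A e" for g
  proof -
    obtain x where g: "g \<in> carrier G" and x: "x \<in> c g" "x \<otimes> e \<noteq> \<zero>" using gA unfolding A_def by blast
    have xS: "x \<in> carrier S" using x g c_carrier by blast
    have gi: "inv\<^bsub>G\<^esub> g \<in> carrier G" using g by simp
    obtain \<epsilon> where \<epsilon>: "\<epsilon> \<in> ring_setmult S (c (inv\<^bsub>G\<^esub> g)) (c g)" "\<And>y. y \<in> c g \<Longrightarrow> y \<otimes> \<epsilon> = y"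
      using unit[OF g] by blast
    have "\<exists>v\<in>c (inv\<^bsub>G\<^esub> g). \<exists>u\<in>c g. \<not> nilp (e \<otimes> (v \<otimes> u) \<otimes> e)"
    proof (rule ccontr)
      assume neg: "\<not> ?thesis"
      have prod: "v \<otimes> u \<in> ?R" if "v \<in> c (inv\<^bsub>G\<^esub> g)" "u \<in> c g" for u v
        using mult_c[OF gi g that] g by simp
      have sandwich: "e \<otimes> z \<otimes> e \<in> ?R \<and> e \<otimes> (e \<otimes> z \<otimes> e) = e \<otimes> z \<otimes> e \<and> (e \<otimes> z \<otimes> e) \<otimes> e = e \<otimes> z \<otimes> e"
        if "z \<in> ?R" for z
      proof -
        have "e \<otimes> (e \<otimes> z \<otimes> e) = (e \<otimes> e) \<otimes> z \<otimes> e" "(e \<otimes> z \<otimes> e) \<otimes> e = e \<otimes> z \<otimes> (e \<otimes> e)"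
          using eS RS[OF that] by (simp_all add: m_assoc)
        then show ?thesis using e that Rm by simp
      qed
      have "z \<in> ?R \<and> nilp (e \<otimes> z \<otimes> e)" if "z \<in> ring_setmult S (c (inv\<^bsub>G\<^esub> g)) (c g)" for z
        using that unfolding ring_setmult_def
      proof (induction rule: generate.induct)
        case one
        then show ?case using c_zero eS nilp_zero by simp
      next
        case (incl h)
        then show ?case using neg prod by auto
      next
        case (inv h)
        then obtain v u where h: "v \<in> c (inv\<^bsub>G\<^esub> g)" "u \<in> c g" "h = v \<otimes> u" by blast
        have vu: "v \<in> carrier S" "u \<in> carrier S" using h c_carrier g gi by blast+
        have "inv\<^bsub>add_monoid S\<^esub> h = (\<ominus> v) \<otimes> u" using h vu by (simp add: a_inv_def[symmetric] l_minus)
        moreover have "\<ominus> v \<in> c (inv\<^bsub>G\<^esub> g)" using h c_minus gi by blast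
        ultimately show ?case using neg prod h by auto
      next
        case (eng h1 h2)
        have "e \<otimes> (h1 \<oplus> h2) \<otimes> e = (e \<otimes> h1 \<otimes> e) \<oplus> (e \<otimes> h2 \<otimes> e)"
          using eS eng RS by (simp add: l_distr r_distr)
        moreover have "nilp ((e \<otimes> h1 \<otimes> e) \<oplus> (e \<otimes> h2 \<otimes> e))"
          by (rule nilp_add) (use sandwich eng in blast)+
        ultimately show ?case using eng c_add by simp
      qed
      then have \<epsilon>n: "\<epsilon> \<in> ?R" "nilp (e \<otimes> \<epsilon> \<otimes> e)" using \<epsilon>(1) by blast+
      define w where "w = e \<otimes> \<epsilon> \<otimes> e"
      have wS: "w \<in> carrier S" unfolding w_def using eS \<epsilon>n RS by simp
      \<comment> \<open>The local unit acts trivially on \<open>x e\<close>, which again has degree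
        \<open>g\<close>. Hence every power of \<open>w\<close> fixes the nonzero
        \<open>x e\<close>, and \<open>w\<close> cannot be nilpotent.\<close>
      have xw: "(x \<otimes> e) \<otimes> w = x \<otimes> e"
      proof -
        have "(x \<otimes> e) \<otimes> w = (x \<otimes> (e \<otimes> e)) \<otimes> \<epsilon> \<otimes> e"
          unfolding w_def using xS eS RS[OF \<epsilon>n(1)] by (simp add: m_assoc)
        also have "\<dots> = x \<otimes> e \<otimes> e" using \<epsilon>(2)[of "x \<otimes> e"] c_mult_one[OF g x(1) e(1)] e by simp
        also have "\<dots> = x \<otimes> e" using xS eS e by (simp add: m_assoc)
        finally show ?thesis .
      qed
      have "(x \<otimes> e) \<otimes> w [^] n = x \<otimes> e" for n :: nat
      proof (induction n)
        case (Suc n)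
        have "(x \<otimes> e) \<otimes> w [^] Suc n = ((x \<otimes> e) \<otimes> w [^] n) \<otimes> w" using xS eS wS by (simp add: m_assoc)
        then show ?case using Suc xw by simp
      qed (use xS eS in simp)
      moreover obtain n :: nat where "w [^] n = \<zero>" using \<epsilon>n unfolding nilp_def w_def by blast
      ultimately have "x \<otimes> e = \<zero>" using xS eS by (metis m_closed r_null)
      then show False using x by simp
    qed
    then obtain v u where vu: "v \<in> c (inv\<^bsub>G\<^esub> g)" "u \<in> c g" "\<not> nilp (e \<otimes> (v \<otimes> u) \<otimes> e)" by blast
    have S: "v \<in> carrier S" "u \<in> carrier S" using vu c_carrier g gi by blast+
    have "v \<otimes> u \<in> ?R" using mult_c[OF gi g vu(1,2)] g by simp
    then have "e \<otimes> (v \<otimes> u) \<otimes> e \<in> ?R" using Rm e by blast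
    moreover have "e \<otimes> (e \<otimes> (v \<otimes> u) \<otimes> e) = (e \<otimes> e) \<otimes> (v \<otimes> u) \<otimes> e"
      "(e \<otimes> (v \<otimes> u) \<otimes> e) \<otimes> e = e \<otimes> (v \<otimes> u) \<otimes> (e \<otimes> e)" using S eS by (simp_all add: m_assoc)
    ultimately obtain t where t: "t \<in> ?R" "e \<otimes> t = t" "t \<otimes> (e \<otimes> (v \<otimes> u) \<otimes> e) = e"
      using left_inv[of "e \<otimes> (v \<otimes> u) \<otimes> e"] vu(3) e by auto
    have tS: "t \<in> carrier S" using t RS by blast
    \<comment> \<open>The corner inverse \<open>t\<close> is absorbed into the left factor; the pair
      is \<open>u e\<close> and \<open>t e v\<close>.\<close>
    show ?thesis
    proof (intro exI conjI)
      show "u \<otimes> e \<in> c g" using c_mult_one g vu e by blast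
      show "t \<otimes> e \<otimes> v \<in> c (inv\<^bsub>G\<^esub> g)" using c_one_mult[OF gi] Rm t e vu by blast
      show "u \<otimes> e \<otimes> e = u \<otimes> e" using S eS e by (simp add: m_assoc)
      show "e \<otimes> (t \<otimes> e \<otimes> v) = t \<otimes> e \<otimes> v" using S eS tS t(2) by (simp add: m_assoc[symmetric])
      show "(t \<otimes> e \<otimes> v) \<otimes> (u \<otimes> e) = e" using S eS tS t(3) by (simp add: m_assoc)
    qed
  qed
  then obtain u v where uv: "\<And>g. g \<in> A e \<Longrightarrow> u g \<in> c g" "\<And>g. g \<in> A e \<Longrightarrow> v g \<in> c (inv\<^bsub>G\<^esub> g)"
    "\<And>g. g \<in> A e \<Longrightarrow> u g \<otimes> e = u g" "\<And>g. g \<in> A e \<Longrightarrow> e \<otimes> v g = v g" "\<And>g. g \<in> A e \<Longrightarrow> v g \<otimes> u g = e"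
    by metis
  \<comment> \<open>A sequence of distinct degrees is what indexes the descending chain of
    ideals.\<close>
  obtain s :: "nat \<Rightarrow> 'g" where s: "inj s" "range s \<subseteq> A e"
    using infinite_countable_subset[OF e(3)] by blast
  have sA: "s i \<in> A e" for i using s by blast
  have sG: "s i \<in> carrier G" "inv\<^bsub>G\<^esub> (s i) \<in> carrier G" for i using sA unfolding A_def by auto
  define U where "U i = u (s i)" for i
  define V where "V i = v (s i)" for i
  have U: "U i \<in> c (s i)" "U i \<otimes> e = U i" for i unfolding U_def using uv sA by auto
  have V: "V i \<in> c (inv\<^bsub>G\<^esub> (s i))" "e \<otimes> V i = V i" for i unfolding V_def using uv sA by auto
  have VU: "V i \<otimes> U i = e" for i unfolding V_def U_def using uv sA by auto
  have US: "U i \<in> carrier S" and VS: "V i \<in> carrier S" for i using U V c_carrier sG by blast+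
  have mid: "V i \<otimes> r \<otimes> U i \<in> ?R" "e \<otimes> (V i \<otimes> r \<otimes> U i) = V i \<otimes> r \<otimes> U i"
    "(V i \<otimes> r \<otimes> U i) \<otimes> e = V i \<otimes> r \<otimes> U i" if "r \<in> ?R" for r i
  proof -
    show "V i \<otimes> r \<otimes> U i \<in> ?R"
      using mult_c[OF sG(2)[of i] sG(1)[of i] c_mult_one[OF sG(2) V(1) that] U(1)] sG by simp
    show "e \<otimes> (V i \<otimes> r \<otimes> U i) = V i \<otimes> r \<otimes> U i"
      using V(2) VS US eS RS[OF that] by (simp add: m_assoc[symmetric])
    show "(V i \<otimes> r \<otimes> U i) \<otimes> e = V i \<otimes> r \<otimes> U i"
      using U(2) VS US eS RS[OF that] by (simp add: m_assoc)
  qed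
  have UV: "U i \<otimes> V i \<in> ?R" for i using mult_c[OF sG(1)[of i] sG(2)[of i] U(1) V(1)] sG by simp
  \<comment> \<open>Quantifying over \<open>t\<close> builds in closure under left multiplication.
    These ideals separate the elements \<open>U j V j\<close>: each lies in \<open>P i\<close> for
    \<open>i \<noteq> j\<close> but not in \<open>P j\<close>.\<close>
  define P where "P i = {r \<in> ?R. \<forall>t\<in>?R. nilp (V i \<otimes> (t \<otimes> r) \<otimes> U i)}" for i
  have other: "U j \<otimes> V j \<in> P i" if "i \<noteq> j" for i j
  proof -
    have "nilp (V i \<otimes> (t \<otimes> (U j \<otimes> V j)) \<otimes> U i)" if t: "t \<in> ?R" for t
    proof (rule ccontr)
      assume n: "\<not> ?thesis"
      obtain w where w: "w \<in> ?R" "e \<otimes> w = w" "w \<otimes> (V i \<otimes> (t \<otimes> (U j \<otimes> V j)) \<otimes> U i) = e"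
        using left_inv[OF mid[OF Rm[OF t UV]] n] by blast
      \<comment> \<open>Regrouping the inverse relation as \<open>p (V j U i) = e\<close> isolates a
        factor \<open>p\<close> of this nontrivial degree. Torsion-freeness makes \<open>p\<close>
        nilpotent, so it cannot have such a right inverse.\<close>
      let ?k = "inv\<^bsub>G\<^esub> (s i) \<otimes>\<^bsub>G\<^esub> s j"
      let ?p = "w \<otimes> V i \<otimes> (t \<otimes> U j)"
      have k: "?k \<in> carrier G" using sG by simp
      have p: "?p \<in> c ?k"
        by (intro mult_c sG c_one_mult w V t U)
      have "s i \<noteq> s j" using s(1) \<open>i \<noteq> j\<close> by (auto dest: injD)
      then have "?k \<noteq> \<one>\<^bsub>G\<^esub>" using sG by (metis G.inv_solve_left' G.r_one G.one_closed)
      then have "nilp ?p"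
        using homogeneous_nilp[OF art k _ p] tf k unfolding torsion_free_group_def by blast
      moreover have "?p \<otimes> (V j \<otimes> U i) = e"
        using w(3) RS[OF w(1)] RS[OF t] US VS by (simp add: m_assoc)
      moreover have "e \<otimes> (V j \<otimes> U i) = V j \<otimes> U i" using V(2) US VS eS by (simp add: m_assoc[symmetric])
      ultimately show False
        using left_inverse_not_nilp(1)[of ?p "V j \<otimes> U i" e] RS[OF w(1)] RS[OF t] US VS eS e0 by simp
    qed
    then show ?thesis unfolding P_def using UV by blast
  qed
  have self: "U i \<otimes> V i \<notin> P i" for i
  proof
    assume "U i \<otimes> V i \<in> P i"
    then have "nilp (V i \<otimes> (\<one> \<otimes> (U i \<otimes> V i)) \<otimes> U i)" unfolding P_def using one_mem by blast
    moreover have "V i \<otimes> (\<one> \<otimes> (U i \<otimes> V i)) \<otimes> U i = (V i \<otimes> U i) \<otimes> (V i \<otimes> U i)"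
      using US VS by (simp add: m_assoc)
    ultimately have "nilp e" using VU e by simp
    then show False using left_inverse_not_nilp(1)[of e e e] eS e e0 by simp
  qed
  have ideal: "left_ideal (P i) principal" for i
    unfolding left_ideal_principal_iff
  proof (intro conjI ballI)
    show "\<zero> \<in> P i" unfolding P_def using c_zero nilp_zero RS US VS by simp
  next
    fix x y assume "x \<in> P i" "y \<in> P i"
    then have xy: "x \<in> ?R" "y \<in> ?R" "\<And>t. t \<in> ?R \<Longrightarrow> nilp (V i \<otimes> (t \<otimes> x) \<otimes> U i)"
      "\<And>t. t \<in> ?R \<Longrightarrow> nilp (V i \<otimes> (t \<otimes> y) \<otimes> U i)" unfolding P_def by auto
    have "nilp (V i \<otimes> (t \<otimes> (x \<oplus> y)) \<otimes> U i)" if t: "t \<in> ?R" for t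
    proof -
      \<comment> \<open>Both summands are nilpotents of the corner, so closure of \<open>P i\<close>
        under sums is again locality.\<close>
      have "V i \<otimes> (t \<otimes> (x \<oplus> y)) \<otimes> U i = (V i \<otimes> (t \<otimes> x) \<otimes> U i) \<oplus> (V i \<otimes> (t \<otimes> y) \<otimes> U i)"
        using US VS RS xy(1,2) t by (simp add: l_distr r_distr)
      then show ?thesis using nilp_add mid xy t Rm by simp
    qed
    then show "x \<oplus> y \<in> P i" unfolding P_def using xy c_add by simp
  next
    fix r x assume r: "r \<in> ?R" and "x \<in> P i"
    then have x: "x \<in> ?R" "\<And>t. t \<in> ?R \<Longrightarrow> nilp (V i \<otimes> (t \<otimes> x) \<otimes> U i)" unfolding P_def by auto
    have "nilp (V i \<otimes> (t \<otimes> (r \<otimes> x)) \<otimes> U i)" if t: "t \<in> ?R" for t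
      using x(2)[OF Rm[OF t r]] RS[OF t] RS[OF r] RS[OF x(1)] by (simp add: m_assoc)
    then show "r \<otimes> x \<in> P i" unfolding P_def using x r Rm by simp
  qed (auto simp: P_def)
  \<comment> \<open>The chain is strict at each index, since \<open>U n V n\<close> lies in
    \<open>K n\<close> but not in \<open>K (Suc n)\<close>.\<close>
  define K where "K n = {r \<in> ?R. \<forall>i<n. r \<in> P i}" for n :: nat
  have "left_ideal (K n) principal" for n
    using ideal c_zero c_add Rm unfolding left_ideal_principal_iff K_def by auto
  moreover have "K (Suc n) \<subseteq> K n" for n unfolding K_def by auto
  ultimately obtain N where "\<forall>n\<ge>N. K n = K N"
    using artR[unfolded left_artinian_def, rule_format, of K] by blast
  then have "K (Suc N) = K N" by (meson le_SucI order_refl)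
  moreover have "U N \<otimes> V N \<in> K N" unfolding K_def using other UV by auto
  ultimately have "U N \<otimes> V N \<in> P N" unfolding K_def by blast
  then show False using self by blast
qed

end

section \<open>Finitely generated modules over the principal component\<close>

context graded
begin

text \<open>Left modules over \<open>S_e\<close> inside \<open>S\<close>. Negatives come for free
  from the scalar \<open>-1\<close>.\<close>

definition submodule :: "'a set \<Rightarrow> bool" where
  "submodule M \<longleftrightarrow> M \<subseteq> carrier S \<and> \<zero> \<in> M \<and> (\<forall>x\<in>M. \<forall>y\<in>M. x \<oplus> y \<in> M)
     \<and> (\<forall>r\<in>c \<one>\<^bsub>G\<^esub>. \<forall>x\<in>M. r \<otimes> x \<in> M)"

text \<open>The left \<open>S_e\<close>-span of the list, in a recursive form that exposes the
  coefficient of the first generator for the induction on chains.\<close>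

primrec lspan :: "'a list \<Rightarrow> 'a set" where
  "lspan [] = {\<zero>}"
| "lspan (v # vs) = {r \<otimes> v \<oplus> m | r m. r \<in> c \<one>\<^bsub>G\<^esub> \<and> m \<in> lspan vs}"

lemma submodule_minus:
  assumes "submodule M" "x \<in> M" "y \<in> M"
  shows "x \<ominus> y \<in> M"
proof -
  have S: "x \<in> carrier S" "y \<in> carrier S" using assms unfolding submodule_def by auto
  have "\<ominus> \<one> \<in> c \<one>\<^bsub>G\<^esub>" using one_mem c_minus by simp
  then have "(\<ominus> \<one>) \<otimes> y \<in> M" using assms unfolding submodule_def by blast
  then have "\<ominus> y \<in> M" using S by (simp add: l_minus)
  then show ?thesis using assms unfolding submodule_def by (simp add: minus_eq)
qed

lemma lspan_carrier:
  "set vs \<subseteq> carrier S \<Longrightarrow> x \<in> lspan vs \<Longrightarrow> x \<in> carrier S"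
  by (induction vs arbitrary: x) (auto dest: c_one_carrier)

lemma lspan_append:
  assumes "set vs \<subseteq> carrier S" "set ws \<subseteq> carrier S" "x \<in> lspan vs" "y \<in> lspan ws"
  shows "x \<oplus> y \<in> lspan (vs @ ws)"
  using assms
proof (induction vs arbitrary: x)
  case Nil
  then show ?case using lspan_carrier by simp
next
  case (Cons v vs)
  then obtain r m where r: "r \<in> c \<one>\<^bsub>G\<^esub>" "m \<in> lspan vs" "x = r \<otimes> v \<oplus> m" by auto
  have "m \<oplus> y \<in> lspan (vs @ ws)" using Cons r by simp
  moreover have "x \<oplus> y = r \<otimes> v \<oplus> (m \<oplus> y)"
    using r Cons.prems lspan_carrier[of vs m] lspan_carrier[of ws y] c_one_carrier by (simp add: a_assoc)
  ultimately show ?case using r by auto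
qed

lemma submodule_lspan:
  assumes "set vs \<subseteq> carrier S"
  shows "submodule (lspan vs)"
  using assms
proof (induction vs)
  case Nil
  then show ?case unfolding submodule_def using c_one_carrier by auto
next
  case (Cons v vs)
  then have IH: "submodule (lspan vs)" and v: "v \<in> carrier S" by auto
  have mS: "m \<in> carrier S" if "m \<in> lspan vs" for m using IH that unfolding submodule_def by blast
  show ?case
    unfolding submodule_def
  proof (intro conjI ballI)
    show "lspan (v # vs) \<subseteq> carrier S" using lspan_carrier Cons.prems by blast
    have "\<zero> = \<zero> \<otimes> v \<oplus> \<zero>" using v by simp
    then show "\<zero> \<in> lspan (v # vs)" using IH c_zero[of "\<one>\<^bsub>G\<^esub>"] unfolding submodule_def by auto
  next
    fix x y assume "x \<in> lspan (v # vs)" "y \<in> lspan (v # vs)"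
    then obtain r m r' m' where xy: "r \<in> c \<one>\<^bsub>G\<^esub>" "m \<in> lspan vs" "x = r \<otimes> v \<oplus> m"
      "r' \<in> c \<one>\<^bsub>G\<^esub>" "m' \<in> lspan vs" "y = r' \<otimes> v \<oplus> m'" by auto
    then have "x \<oplus> y = (r \<oplus> r') \<otimes> v \<oplus> (m \<oplus> m')"
      using v mS c_one_carrier by (simp add: l_distr a_ac)
    moreover have "m \<oplus> m' \<in> lspan vs" using xy IH unfolding submodule_def by blast
    moreover have "r \<oplus> r' \<in> c \<one>\<^bsub>G\<^esub>" using xy c_add by simp
    ultimately show "x \<oplus> y \<in> lspan (v # vs)" by auto
  next
    fix s x assume s: "s \<in> c \<one>\<^bsub>G\<^esub>" and "x \<in> lspan (v # vs)"
    then obtain r m where x: "r \<in> c \<one>\<^bsub>G\<^esub>" "m \<in> lspan vs" "x = r \<otimes> v \<oplus> m" by auto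
    then have "s \<otimes> x = (s \<otimes> r) \<otimes> v \<oplus> s \<otimes> m"
      using v mS c_one_carrier s by (simp add: r_distr m_assoc)
    moreover have "s \<otimes> m \<in> lspan vs" using x s IH unfolding submodule_def by blast
    moreover have "s \<otimes> r \<in> c \<one>\<^bsub>G\<^esub>" using x s c_one_mult by simp
    ultimately show "s \<otimes> x \<in> lspan (v # vs)" by auto
  qed
qed

text \<open>Finitely generated modules over an artinian ring satisfy the descending chain condition.
  By induction on generators, both the left ideals of first coefficients and the intersections with
  the span of the rest become stationary, and together they determine the chain.\<close>

lemma lspan_dcc:
  assumes art: "left_artinian principal"
    and "set vs \<subseteq> carrier S" "\<And>n. submodule (I n)" "\<And>n. I (Suc n) \<subseteq> I n" "\<And>n. I n \<subseteq> lspan vs"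
  shows "\<exists>N. \<forall>n\<ge>N. I n = I N"
  using assms(2-)
proof (induction vs arbitrary: I)
  case Nil
  have "I n = {\<zero>}" for n using Nil(2)[of n] Nil(4)[of n] unfolding submodule_def by auto
  then show ?case by simp
next
  case (Cons v vs)
  have v: "v \<in> carrier S" and vs: "set vs \<subseteq> carrier S" using Cons.prems by auto
  note M = submodule_lspan[OF vs]
  have mS: "m \<in> carrier S" if "m \<in> lspan vs" for m using M that unfolding submodule_def by blast
  have anti: "I n \<subseteq> I m" if "m \<le> n" for m n using lift_Suc_antimono_le[of I] Cons.prems(3) that by blast
  have I: "I n \<subseteq> carrier S" "\<zero> \<in> I n" "\<And>x y. x \<in> I n \<Longrightarrow> y \<in> I n \<Longrightarrow> x \<oplus> y \<in> I n"
    "\<And>r x. r \<in> c \<one>\<^bsub>G\<^esub> \<Longrightarrow> x \<in> I n \<Longrightarrow> r \<otimes> x \<in> I n" for n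
    using Cons.prems(2)[of n] unfolding submodule_def by auto
  define L where "L n = {r \<in> c \<one>\<^bsub>G\<^esub>. \<exists>m\<in>lspan vs. r \<otimes> v \<oplus> m \<in> I n}" for n
  have "left_ideal (L n) principal" for n
    unfolding left_ideal_principal_iff
  proof (intro conjI ballI)
    have "\<zero> \<otimes> v \<oplus> \<zero> \<in> I n" using v I by simp
    then show "\<zero> \<in> L n" unfolding L_def using M c_zero[of "\<one>\<^bsub>G\<^esub>"] unfolding submodule_def by auto
  next
    fix x y assume "x \<in> L n" "y \<in> L n"
    then obtain m m' where xy: "x \<in> c \<one>\<^bsub>G\<^esub>" "y \<in> c \<one>\<^bsub>G\<^esub>" "m \<in> lspan vs" "m' \<in> lspan vs"
      "x \<otimes> v \<oplus> m \<in> I n" "y \<otimes> v \<oplus> m' \<in> I n" unfolding L_def by blast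
    have "(x \<oplus> y) \<otimes> v \<oplus> (m \<oplus> m') = (x \<otimes> v \<oplus> m) \<oplus> (y \<otimes> v \<oplus> m')"
      using v mS xy(1-4) c_one_carrier by (simp add: l_distr a_ac)
    then have "(x \<oplus> y) \<otimes> v \<oplus> (m \<oplus> m') \<in> I n" using I(3)[OF xy(5,6)] by simp
    moreover have "m \<oplus> m' \<in> lspan vs" using xy M unfolding submodule_def by blast
    ultimately show "x \<oplus> y \<in> L n" unfolding L_def using xy c_add by auto
  next
    fix s x assume s: "s \<in> c \<one>\<^bsub>G\<^esub>" and "x \<in> L n"
    then obtain m where x: "x \<in> c \<one>\<^bsub>G\<^esub>" "m \<in> lspan vs" "x \<otimes> v \<oplus> m \<in> I n" unfolding L_def by blast
    have "(s \<otimes> x) \<otimes> v \<oplus> s \<otimes> m = s \<otimes> (x \<otimes> v \<oplus> m)"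
      using v mS x(1,2) c_one_carrier s by (simp add: r_distr m_assoc)
    then have "(s \<otimes> x) \<otimes> v \<oplus> s \<otimes> m \<in> I n" using I(4)[OF s x(3)] by simp
    moreover have "s \<otimes> m \<in> lspan vs" using x s M unfolding submodule_def by blast
    ultimately show "s \<otimes> x \<in> L n" unfolding L_def using x s c_one_mult by auto
  qed (auto simp: L_def)
  moreover have "L (Suc n) \<subseteq> L n" for n using Cons.prems(3)[of n] unfolding L_def by blast
  ultimately obtain N1 where N1: "\<forall>n\<ge>N1. L n = L N1"
    using art[unfolded left_artinian_def, rule_format, of L] by blast
  have "\<exists>N. \<forall>n\<ge>N. I n \<inter> lspan vs = I N \<inter> lspan vs"
  proof (rule Cons.IH[OF vs])
    show "submodule (I n \<inter> lspan vs)" for n using Cons.prems(2)[of n] M unfolding submodule_def by auto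
    show "I (Suc n) \<inter> lspan vs \<subseteq> I n \<inter> lspan vs" for n using Cons.prems(3)[of n] by blast
  qed auto
  then obtain N2 where N2: "\<forall>n\<ge>N2. I n \<inter> lspan vs = I N2 \<inter> lspan vs" by blast
  let ?N = "max N1 N2"
  have "I n = I ?N" if n: "n \<ge> ?N" for n
  proof
    show "I n \<subseteq> I ?N" by (rule anti[OF n])
    show "I ?N \<subseteq> I n"
    proof
      fix x assume x: "x \<in> I ?N"
      then obtain r m where r: "r \<in> c \<one>\<^bsub>G\<^esub>" "m \<in> lspan vs" "x = r \<otimes> v \<oplus> m"
        using Cons.prems(4)[of ?N] by auto
      have "r \<in> L ?N" unfolding L_def using r x by auto
      then have "r \<in> L n" using N1 n by (metis max.bounded_iff order_refl)
      then obtain m' where m': "m' \<in> lspan vs" "r \<otimes> v \<oplus> m' \<in> I n" unfolding L_def by blast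
      let ?y = "r \<otimes> v \<oplus> m'"
      have yS: "?y \<in> carrier S" and xS: "x \<in> carrier S" using m' x I by blast+
      \<comment> \<open>The element \<open>?y\<close> of \<open>I n\<close> has the same first
        coefficient as \<open>x\<close>, so the difference lies in the span of the remaining
        generators, where the chain is already stationary.\<close>
      have "x \<ominus> ?y \<in> I ?N" using submodule_minus Cons.prems(2) x m' anti[OF n] by blast
      moreover have "x \<ominus> ?y = m \<ominus> m'"
      proof -
        have p: "r \<otimes> v \<in> carrier S" using r v c_one_carrier by simp
        have "(m \<ominus> m') \<oplus> (m' \<oplus> r \<otimes> v) = m \<oplus> r \<otimes> v"
          using p mS r(2) m'(1) by (simp add: minus_eq a_assoc r_neg1)
        then have "x = (m \<ominus> m') \<oplus> ?y"
          using p r(3) mS r(2) m'(1) by (metis a_comm)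
        then show ?thesis using mS r m' yS by (simp add: minus_eq a_assoc r_neg)
      qed
      moreover have "m \<ominus> m' \<in> lspan vs" using submodule_minus M r m' by blast
      ultimately have "x \<ominus> ?y \<in> I ?N \<inter> lspan vs" by simp
      then have "x \<ominus> ?y \<in> I n" using N2 n by (metis IntD1 max.bounded_iff order_refl)
      then have "(x \<ominus> ?y) \<oplus> ?y \<in> I n" using m' I by blast
      moreover have "(x \<ominus> ?y) \<oplus> ?y = x" using xS yS by (simp add: minus_eq a_assoc l_neg)
      ultimately show "x \<in> I n" by simp
    qed
  qed
  then show ?case by blast
qed

text \<open>Write the local unit as a finite sum of products \<open>a b\<close>. Then
  \<open>x\<close> is the sum of the \<open>(x a) b\<close> with \<open>x a\<close> in
  \<open>S_e\<close>, so the factors \<open>b\<close> generate \<open>S_g\<close>.\<close>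

lemma component_lspan:
  assumes g: "g \<in> carrier G"
    and unit: "\<exists>\<epsilon>\<in>ring_setmult S (c (inv\<^bsub>G\<^esub> g)) (c g). \<forall>x\<in>c g. x \<otimes> \<epsilon> = x"
  shows "\<exists>vs. set vs \<subseteq> carrier S \<and> c g \<subseteq> lspan vs"
proof -
  have gi: "inv\<^bsub>G\<^esub> g \<in> carrier G" using g by simp
  have single: "\<exists>vs. set vs \<subseteq> carrier S \<and> (\<forall>x\<in>c g. x \<otimes> (a \<otimes> b) \<in> lspan vs)"
    if "a \<in> c (inv\<^bsub>G\<^esub> g)" "b \<in> c g" for a b
  proof (intro exI conjI ballI)
    have S: "a \<in> carrier S" "b \<in> carrier S" using that c_carrier g gi by blast+
    show "set [b] \<subseteq> carrier S" using S by simp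
    fix x assume x: "x \<in> c g"
    have "x \<otimes> a \<in> c \<one>\<^bsub>G\<^esub>" using mult_c[OF g gi x that(1)] g by simp
    moreover have "x \<otimes> (a \<otimes> b) = (x \<otimes> a) \<otimes> b \<oplus> \<zero>" using S c_carrier[OF g x] by (simp add: m_assoc)
    ultimately show "x \<otimes> (a \<otimes> b) \<in> lspan [b]" by auto
  qed
  \<comment> \<open>The list depends on \<open>z\<close> but must serve all \<open>x\<close> at
    once; sums concatenate the lists, and a negated product is again a product.\<close>
  have "z \<in> carrier S \<and> (\<exists>vs. set vs \<subseteq> carrier S \<and> (\<forall>x\<in>c g. x \<otimes> z \<in> lspan vs))"
    if "z \<in> ring_setmult S (c (inv\<^bsub>G\<^esub> g)) (c g)" for z
    using that unfolding ring_setmult_def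
  proof (induction rule: generate.induct)
    case one
    show ?case using c_carrier[OF g] by (auto intro!: exI[of _ "[]"])
  next
    case (incl h)
    then obtain a b where "a \<in> c (inv\<^bsub>G\<^esub> g)" "b \<in> c g" "h = a \<otimes> b" by blast
    then show ?case using single c_carrier g gi by blast
  next
    case (inv h)
    then obtain a b where h: "a \<in> c (inv\<^bsub>G\<^esub> g)" "b \<in> c g" "h = a \<otimes> b" by blast
    have S: "a \<in> carrier S" "b \<in> carrier S" using h c_carrier g gi by blast+
    have "inv\<^bsub>add_monoid S\<^esub> h = (\<ominus> a) \<otimes> b" using h S by (simp add: a_inv_def[symmetric] l_minus)
    moreover have "\<ominus> a \<in> c (inv\<^bsub>G\<^esub> g)" using h c_minus gi by blast
    ultimately show ?case using single h S by auto
  next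
    case (eng h1 h2)
    obtain vs ws where vw: "set vs \<subseteq> carrier S" "\<forall>x\<in>c g. x \<otimes> h1 \<in> lspan vs"
      "set ws \<subseteq> carrier S" "\<forall>x\<in>c g. x \<otimes> h2 \<in> lspan ws" using eng by blast
    have "x \<otimes> (h1 \<oplus> h2) \<in> lspan (vs @ ws)" if "x \<in> c g" for x
      using lspan_append[OF vw(1,3)] vw(2,4) that eng c_carrier[OF g that] by (simp add: r_distr)
    then show ?case using eng vw by (auto intro!: exI[of _ "vs @ ws"])
  qed
  moreover obtain \<epsilon> where "\<epsilon> \<in> ring_setmult S (c (inv\<^bsub>G\<^esub> g)) (c g)" "\<forall>x\<in>c g. x \<otimes> \<epsilon> = x"
    using unit by blast
  ultimately show ?thesis by (metis subsetI)
qed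

text \<open>As a sum of finitely many finitely generated components, \<open>S\<close> is a finitely
  generated left \<open>S_e\<close>-module, and left ideals of \<open>S\<close> are submodules of
  it.\<close>

lemma left_artinian_if_finite_support:
  assumes art: "left_artinian principal" and fin: "finite {g \<in> carrier G. c g \<noteq> {\<zero>}}"
    and unit: "\<And>g. g \<in> carrier G \<Longrightarrow> \<exists>\<epsilon>\<in>ring_setmult S (c (inv\<^bsub>G\<^esub> g)) (c g). \<forall>x\<in>c g. x \<otimes> \<epsilon> = x"
  shows "left_artinian S"
proof -
  let ?F = "{g \<in> carrier G. c g \<noteq> {\<zero>}}"
  have "\<exists>vs. set vs \<subseteq> carrier S \<and> (\<forall>f. (\<forall>g\<in>F. f g \<in> c g) \<longrightarrow> finsum S f F \<in> lspan vs)"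
    if "finite F" "F \<subseteq> carrier G" for F
    using that
  proof (induction F rule: finite_induct)
    case empty
    show ?case by (auto intro!: exI[of _ "[]"])
  next
    case (insert g F)
    then obtain vs where vs: "set vs \<subseteq> carrier S" "\<And>f. (\<forall>g\<in>F. f g \<in> c g) \<Longrightarrow> finsum S f F \<in> lspan vs" by auto
    obtain ws where ws: "set ws \<subseteq> carrier S" "c g \<subseteq> lspan ws"
      using component_lspan[of g] unit insert.prems by auto
    have "finsum S f (insert g F) \<in> lspan (ws @ vs)" if f: "\<forall>h\<in>insert g F. f h \<in> c h" for f
    proof -
      have "f \<in> F \<rightarrow> carrier S" "f g \<in> carrier S" using f c_carrier insert.prems by auto
      then have "finsum S f (insert g F) = f g \<oplus> finsum S f F" using insert by (intro finsum_insert) auto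
      moreover have "f g \<oplus> finsum S f F \<in> lspan (ws @ vs)" using lspan_append ws vs f by auto
      ultimately show ?thesis by simp
    qed
    then show ?case using ws vs by (intro exI[of _ "ws @ vs"]) auto
  qed
  then obtain vs where vs: "set vs \<subseteq> carrier S" "\<And>f. (\<forall>g\<in>?F. f g \<in> c g) \<Longrightarrow> finsum S f ?F \<in> lspan vs"
    using fin by (metis (no_types, lifting) mem_Collect_eq subsetI)
  have all: "x \<in> lspan vs" if x: "x \<in> carrier S" for x
  proof -
    obtain B where B: "finite B" "B \<subseteq> carrier G" "\<forall>g\<in>carrier G - B. proj x g = \<zero>" "x = finsum S (proj x) B"
      using decomp_proj[OF x] unfolding decomp_def by blast
    have p: "\<forall>g\<in>carrier G. proj x g \<in> c g" using proj_mem x by blast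
    have "finsum S (proj x) B = finsum S (proj x) (B \<union> ?F)"
      by (rule decomp_superset[OF p]) (use B fin in auto)
    also have "\<dots> = finsum S (proj x) ?F"
      by (rule decomp_superset[OF p, symmetric]) (use B fin p in auto)
    finally show ?thesis using vs(2)[of "proj x"] p B(4) by simp
  qed
  show ?thesis
    unfolding left_artinian_def
  proof (intro allI impI)
    fix I :: "nat \<Rightarrow> 'a set"
    assume I: "(\<forall>n. left_ideal (I n) S) \<and> (\<forall>n. I (Suc n) \<subseteq> I n)"
    show "\<exists>N. \<forall>n\<ge>N. I n = I N"
    proof (rule lspan_dcc[OF art vs(1)])
      show "submodule (I n)" for n
        using I c_one_carrier unfolding left_ideal_iff submodule_def by blast
      then show "I n \<subseteq> lspan vs" for n using all unfolding submodule_def by blast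
    qed (use I in blast)
  qed
qed

end

section \<open>The opposite ring\<close>

text \<open>Only the multiplication field is replaced, so finite sums, additive subgroups and
  generated additive groups are literally those of \<open>S\<close>.\<close>

definition opposite :: "('a, 'c) ring_scheme \<Rightarrow> ('a, 'c) ring_scheme" where
  "opposite S = S\<lparr>mult := \<lambda>x y. y \<otimes>\<^bsub>S\<^esub> x\<rparr>"

lemma opposite_simps [simp]:
  "carrier (opposite S) = carrier S" "x \<otimes>\<^bsub>opposite S\<^esub> y = y \<otimes>\<^bsub>S\<^esub> x"
  "\<one>\<^bsub>opposite S\<^esub> = \<one>\<^bsub>S\<^esub>" "\<zero>\<^bsub>opposite S\<^esub> = \<zero>\<^bsub>S\<^esub>" "add (opposite S) = add S"
  "add_monoid (opposite S) = add_monoid S"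
  unfolding opposite_def by simp_all

lemma opposite_update_carrier: "(opposite S)\<lparr>carrier := A\<rparr> = opposite (S\<lparr>carrier := A\<rparr>)"
  unfolding opposite_def by simp

lemma finsum_opposite: "finsum (opposite S) = finsum S"
  by (intro ext) (simp add: finsum_def)

lemma additive_subgroup_opposite: "additive_subgroup H (opposite S) \<longleftrightarrow> additive_subgroup H S"
  unfolding additive_subgroup_def by simp

lemma left_artinian_opposite: "left_artinian (opposite S) \<longleftrightarrow> right_artinian S"
  unfolding left_artinian_def right_artinian_def left_ideal_def right_ideal_def
  by (simp add: additive_subgroup_opposite)

lemma ring_setmult_opposite: "ring_setmult (opposite S) A B = ring_setmult S B A"
proof -
  have "{a \<otimes>\<^bsub>opposite S\<^esub> b | a b. a \<in> A \<and> b \<in> B} = {a \<otimes>\<^bsub>S\<^esub> b | a b. a \<in> B \<and> b \<in> A}" by auto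
  then show ?thesis unfolding ring_setmult_def by simp
qed

lemma (in ring) ring_opposite: "ring (opposite R)"
proof (rule ringI)
  show "abelian_group (opposite R)"
    by (rule abelian_groupI) (auto simp: a_ac intro!: bexI[of _ "\<ominus> _"] l_neg)
  show "Group.monoid (opposite R)"
    by (rule monoidI) (auto simp: m_assoc)
qed (auto simp: l_distr r_distr)

context graded
begin

text \<open>Inverting degrees compensates for the reversed product, because
  \<open>(g h)^-1 = h^-1 g^-1\<close>. Decompositions carry over by reindexing sums along
  inversion.\<close>

lemma graded_opposite: "graded (opposite S) G (\<lambda>g. c (inv\<^bsub>G\<^esub> g))"
proof (intro graded.intro graded_axioms.intro ring_opposite G.group_axioms)
  have inj: "inj_on (m_inv G) A" if "A \<subseteq> carrier G" for A
    using G.inv_inj that inj_on_subset by blast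
  show "\<one>\<^bsub>opposite S\<^esub> \<noteq> \<zero>\<^bsub>opposite S\<^esub>" using one_neq_zero by simp
  show "additive_subgroup (c (inv\<^bsub>G\<^esub> g)) (opposite S)" if "g \<in> carrier G" for g
    using subgroup_c that by (simp add: additive_subgroup_opposite)
  show "x \<otimes>\<^bsub>opposite S\<^esub> y \<in> c (inv\<^bsub>G\<^esub> (g \<otimes>\<^bsub>G\<^esub> h))"
    if "g \<in> carrier G" "h \<in> carrier G" "x \<in> c (inv\<^bsub>G\<^esub> g)" "y \<in> c (inv\<^bsub>G\<^esub> h)" for g h x y
    using mult_c[of "inv\<^bsub>G\<^esub> h" "inv\<^bsub>G\<^esub> g" y x] that by (simp add: G.inv_mult_group)
  show "\<exists>A f. finite A \<and> A \<subseteq> carrier G \<and> (\<forall>g\<in>A. f g \<in> c (inv\<^bsub>G\<^esub> g)) \<and> x = finsum (opposite S) f A"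
    if x: "x \<in> carrier (opposite S)" for x
  proof -
    have "x \<in> carrier S" using x by simp
    then obtain A f where A: "finite A" "A \<subseteq> carrier G" "\<forall>g\<in>A. f g \<in> c g" "x = finsum S f A"
      using span_c by blast
    have ii: "inv\<^bsub>G\<^esub> (inv\<^bsub>G\<^esub> g) = g" if "g \<in> A" for g using that A by auto
    have "finsum S (\<lambda>g. f (inv\<^bsub>G\<^esub> g)) (m_inv G ` A) = finsum S (\<lambda>g. f (inv\<^bsub>G\<^esub> (inv\<^bsub>G\<^esub> g))) A"
      by (rule finsum_reindex) (use A ii inj c_carrier in auto)
    also have "\<dots> = finsum S f A"
      by (rule finsum_cong') (use A ii c_carrier in auto)
    finally show ?thesis
      using A ii by (intro exI[of _ "m_inv G ` A"] exI[of _ "\<lambda>g. f (inv\<^bsub>G\<^esub> g)"])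
        (auto simp: finsum_opposite)
  qed
  show "f g = \<zero>\<^bsub>opposite S\<^esub>"
    if "finite A" "A \<subseteq> carrier G" "\<And>g. g \<in> A \<Longrightarrow> f g \<in> c (inv\<^bsub>G\<^esub> g)"
      "finsum (opposite S) f A = \<zero>\<^bsub>opposite S\<^esub>" "g \<in> A" for A f g
  proof -
    have ii: "inv\<^bsub>G\<^esub> (inv\<^bsub>G\<^esub> g) = g" if "g \<in> A" for g using that \<open>A \<subseteq> carrier G\<close> by auto
    have fS: "f k \<in> carrier S" if k: "k \<in> A" for k
      using c_carrier[of "inv\<^bsub>G\<^esub> k" "f k"] k \<open>A \<subseteq> carrier G\<close> that(1)
        \<open>\<And>g. g \<in> A \<Longrightarrow> f g \<in> c (inv\<^bsub>G\<^esub> g)\<close> by auto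
    have "finsum S (\<lambda>g. f (inv\<^bsub>G\<^esub> g)) (m_inv G ` A) = finsum S (\<lambda>g. f (inv\<^bsub>G\<^esub> (inv\<^bsub>G\<^esub> g))) A"
      by (rule finsum_reindex) (use that ii inj fS in auto)
    also have "\<dots> = finsum S f A"
      by (rule finsum_cong') (use ii fS in auto)
    also have "\<dots> = \<zero>" using that by (simp add: finsum_opposite)
    finally have "f (inv\<^bsub>G\<^esub> (inv\<^bsub>G\<^esub> g)) = \<zero>"
      by (rule indep_c[rotated 3]) (use that ii in auto)
    then show ?thesis using ii that by simp
  qed
qed

lemma left_artinian_iff:
  assumes "torsion_free_group G"
    and "\<And>g. g \<in> carrier G \<Longrightarrow> \<exists>\<epsilon>\<in>ring_setmult S (c (inv\<^bsub>G\<^esub> g)) (c g). \<forall>x\<in>c g. x \<otimes> \<epsilon> = x"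
  shows "left_artinian S \<longleftrightarrow> left_artinian principal \<and> finite {g \<in> carrier G. c g \<noteq> {\<zero>}}"
  using assms left_artinian_principal finite_support_if_left_artinian left_artinian_if_finite_support
  by blast

end

lemma graded_ring_imp_graded:
  assumes "graded_ring G S c"
  shows "graded S G c"
proof -
  note defs = assms[unfolded graded_ring_def]
  note h = defs[THEN conjunct2, THEN conjunct2]
  note mult = h[THEN conjunct2, THEN conjunct2, THEN conjunct1]
    and span = h[THEN conjunct2, THEN conjunct2, THEN conjunct2, THEN conjunct1]
    and indep = h[THEN conjunct2, THEN conjunct2, THEN conjunct2, THEN conjunct2]
  show ?thesis
  proof (intro graded.intro graded_axioms.intro)
    show "group G" using defs by (rule conjunct1)
    show "ring S" using defs[THEN conjunct2] by (rule conjunct1)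
    show "\<one>\<^bsub>S\<^esub> \<noteq> \<zero>\<^bsub>S\<^esub>" using h by (rule conjunct1)
    show "additive_subgroup (c g) S" if "g \<in> carrier G" for g
      using h[THEN conjunct2, THEN conjunct1] that by (rule bspec)
    show "x \<otimes>\<^bsub>S\<^esub> y \<in> c (g \<otimes>\<^bsub>G\<^esub> h)"
      if "g \<in> carrier G" "h \<in> carrier G" "x \<in> c g" "y \<in> c h" for g h x y
      using mult[rule_format, OF that] .
    show "\<exists>A f. finite A \<and> A \<subseteq> carrier G \<and> (\<forall>g\<in>A. f g \<in> c g) \<and> x = finsum S f A"
      if "x \<in> carrier S" for x
      using span that by (rule bspec)
    show "f g = \<zero>\<^bsub>S\<^esub>"
      if "finite A" "A \<subseteq> carrier G" "\<And>g. g \<in> A \<Longrightarrow> f g \<in> c g" "finsum S f A = \<zero>\<^bsub>S\<^esub>" "g \<in> A" for A f g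
      using indep[THEN spec, THEN spec, of A f] that by simp
  qed
qed

section \<open>One-sided local units from an epsilon-strong grading\<close>

context
  fixes G :: "('g, 'b) monoid_scheme" and S :: "('a, 'c) ring_scheme" (structure) and c :: "'g \<Rightarrow> 'a set"
  assumes strong: "epsilon_strongly_graded G S c"
begin

interpretation graded S G c
  using strong graded_ring_imp_graded unfolding epsilon_strongly_graded_def by blast

text \<open>The identity of \<open>S_g S_(g^-1)\<close> fixes from the left every generator of
  \<open>S_g S_(g^-1) S_g\<close>, which is \<open>S_g\<close>.\<close>

lemma component_left_unit:
  assumes g: "g \<in> carrier G"
  shows "\<exists>\<epsilon>\<in>ring_setmult S (c g) (c (inv\<^bsub>G\<^esub> g)). \<forall>x\<in>c g. \<epsilon> \<otimes> x = x"
proof -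
  let ?E = "ring_setmult S (c g) (c (inv\<^bsub>G\<^esub> g))"
  obtain \<epsilon> where \<epsilon>: "\<epsilon> \<in> ?E" "\<forall>z\<in>?E. \<epsilon> \<otimes> z = z" and E: "ring_setmult S ?E (c g) = c g"
    using strong g unfolding epsilon_strongly_graded_def by blast
  have ES: "?E \<subseteq> carrier S"
    unfolding ring_setmult_def
    by (intro add.generate_incl[simplified])
      (use c_carrier[OF g] c_carrier[OF G.inv_closed[OF g]] in auto)
  have "x \<in> carrier S \<and> \<epsilon> \<otimes> x = x" if "x \<in> ring_setmult S ?E (c g)" for x
    using that unfolding ring_setmult_def[of S ?E]
  proof (induction rule: generate.induct)
    case one
    then show ?case using \<epsilon> ES by auto
  next
    case (incl h)
    then obtain z y where "z \<in> ?E" "y \<in> c g" "h = z \<otimes> y" by blast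
    moreover have "z \<in> carrier S" "y \<in> carrier S" "\<epsilon> \<in> carrier S" using calculation ES \<epsilon> c_carrier g by blast+
    ultimately show ?case using \<epsilon> by (simp add: m_assoc[symmetric])
  next
    case (inv h)
    then obtain z y where "z \<in> ?E" "y \<in> c g" "h = z \<otimes> y" by blast
    moreover have "z \<in> carrier S" "y \<in> carrier S" "\<epsilon> \<in> carrier S" using calculation ES \<epsilon> c_carrier g by blast+
    ultimately show ?case using \<epsilon> by (simp add: m_assoc[symmetric] a_inv_def[symmetric] r_minus)
  next
    case (eng h1 h2)
    then show ?case using \<epsilon> ES by (auto simp: r_distr)
  qed
  then show ?thesis using \<epsilon> E by blast
qed

text \<open>Here the identity belongs to the ideal for \<open>g^-1\<close>, while \<open>S_g\<close>
  is presented as \<open>(S_g S_(g^-1)) S_g\<close>. Regrouping \<open>(a b) y\<close> as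
  \<open>a (b y)\<close> bridges the two, and requires one induction for sums of the
  \<open>a b\<close> and another for sums of the resulting products.\<close>

lemma component_right_unit:
  assumes g: "g \<in> carrier G"
  shows "\<exists>\<epsilon>\<in>ring_setmult S (c (inv\<^bsub>G\<^esub> g)) (c g). \<forall>x\<in>c g. x \<otimes> \<epsilon> = x"
proof -
  let ?E = "ring_setmult S (c g) (c (inv\<^bsub>G\<^esub> g))" and ?E' = "ring_setmult S (c (inv\<^bsub>G\<^esub> g)) (c g)"
  have gi: "inv\<^bsub>G\<^esub> g \<in> carrier G" using g by simp
  have E: "ring_setmult S ?E (c g) = c g"
    using strong g unfolding epsilon_strongly_graded_def by blast
  obtain \<epsilon> where \<epsilon>: "\<epsilon> \<in> ?E'" "\<forall>z\<in>?E'. z \<otimes> \<epsilon> = z"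
    using strong gi g unfolding epsilon_strongly_graded_def by (metis G.inv_inv)
  have ES: "?E' \<subseteq> carrier S"
    unfolding ring_setmult_def
    by (intro add.generate_incl[simplified]) (use c_carrier[OF g] c_carrier[OF gi] in auto)
  then have \<epsilon>S: "\<epsilon> \<in> carrier S" using \<epsilon> by blast
  have triple: "(a \<otimes> b \<otimes> y) \<otimes> \<epsilon> = a \<otimes> b \<otimes> y" if "a \<in> c g" "b \<in> c (inv\<^bsub>G\<^esub> g)" "y \<in> c g" for a b y
  proof -
    have S: "a \<in> carrier S" "b \<in> carrier S" "y \<in> carrier S" using that g gi c_carrier by blast+
    have "b \<otimes> y \<in> ?E'" unfolding ring_setmult_def using that by (blast intro: generate.incl)
    then have "(b \<otimes> y) \<otimes> \<epsilon> = b \<otimes> y" using \<epsilon> by blast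
    then show ?thesis using S \<epsilon>S by (simp add: m_assoc)
  qed
  have double: "z \<in> carrier S \<and> (\<forall>y\<in>c g. (z \<otimes> y) \<otimes> \<epsilon> = z \<otimes> y)" if "z \<in> ?E" for z
    using that unfolding ring_setmult_def
  proof (induction rule: generate.induct)
    case one
    then show ?case using c_carrier g \<epsilon>S by auto
  next
    case (incl h)
    then show ?case using triple c_carrier g gi by blast
  next
    case (inv h)
    then obtain a b where h: "a \<in> c g" "b \<in> c (inv\<^bsub>G\<^esub> g)" "h = a \<otimes> b" by blast
    have S: "a \<in> carrier S" "b \<in> carrier S" using h c_carrier g gi by blast+
    have "inv\<^bsub>add_monoid S\<^esub> h = (\<ominus> a) \<otimes> b" using h S by (simp add: a_inv_def[symmetric] l_minus)
    moreover have "\<ominus> a \<in> c g" using h c_minus g by blast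
    ultimately show ?case using triple h S by auto
  next
    case (eng h1 h2)
    then show ?case using \<epsilon>S c_carrier[OF g] by (simp add: l_distr)
  qed
  have "x \<in> carrier S \<and> x \<otimes> \<epsilon> = x" if "x \<in> ring_setmult S ?E (c g)" for x
    using that unfolding ring_setmult_def[of S ?E]
  proof (induction rule: generate.induct)
    case one
    then show ?case using \<epsilon>S by auto
  next
    case (incl h)
    then show ?case using double c_carrier g by blast
  next
    case (inv h)
    then obtain z y where "z \<in> ?E" "y \<in> c g" "h = z \<otimes> y" by blast
    moreover have "z \<in> carrier S" "y \<in> carrier S" using calculation double c_carrier g by blast+
    ultimately show ?case using double \<epsilon>S by (simp add: a_inv_def[symmetric] l_minus)
  next
    case (eng h1 h2)
    then show ?case using \<epsilon>S by (auto simp: l_distr)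
  qed
  then show ?thesis using \<epsilon> E by blast
qed

end

theorem theorem1p2:
  fixes G :: "('g, 'b) monoid_scheme" and S :: "('a, 'c) ring_scheme" and c :: "'g \<Rightarrow> 'a set"
  assumes "torsion_free_group G"
    and "epsilon_strongly_graded G S c"
  shows "(left_artinian S \<longleftrightarrow>
            left_artinian (S\<lparr>carrier := c \<one>\<^bsub>G\<^esub>\<rparr>) \<and> finite {g \<in> carrier G. c g \<noteq> {\<zero>\<^bsub>S\<^esub>}})
       \<and> (right_artinian S \<longleftrightarrow>
            right_artinian (S\<lparr>carrier := c \<one>\<^bsub>G\<^esub>\<rparr>) \<and> finite {g \<in> carrier G. c g \<noteq> {\<zero>\<^bsub>S\<^esub>}})"
proof -
  interpret graded S G c
    using assms(2) graded_ring_imp_graded unfolding epsilon_strongly_graded_def by blast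
  interpret op: graded "opposite S" G "\<lambda>g. c (inv\<^bsub>G\<^esub> g)" by (rule graded_opposite)
  \<comment> \<open>Inversion is a bijection between the supports of the two gradings, so they are
    finite together.\<close>
  have "{g \<in> carrier G. c (inv\<^bsub>G\<^esub> g) \<noteq> {\<zero>\<^bsub>S\<^esub>}} = m_inv G ` {g \<in> carrier G. c g \<noteq> {\<zero>\<^bsub>S\<^esub>}}"
    by (force intro: image_eqI[of _ _ "inv\<^bsub>G\<^esub> _"])
  moreover have "inj_on (m_inv G) {g \<in> carrier G. c g \<noteq> {\<zero>\<^bsub>S\<^esub>}}"
    using G.inv_inj by (rule inj_on_subset) auto
  ultimately have fin: "finite {g \<in> carrier G. c (inv\<^bsub>G\<^esub> g) \<noteq> {\<zero>\<^bsub>S\<^esub>}}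
      \<longleftrightarrow> finite {g \<in> carrier G. c g \<noteq> {\<zero>\<^bsub>S\<^esub>}}"
    by (simp add: finite_image_iff)
  \<comment> \<open>A left unit of the component at \<open>g^-1\<close> in \<open>S\<close> is a
    right unit of the component at \<open>g\<close> in the opposite grading.\<close>
  have "\<exists>\<epsilon>\<in>ring_setmult (opposite S) (c (inv\<^bsub>G\<^esub> (inv\<^bsub>G\<^esub> g))) (c (inv\<^bsub>G\<^esub> g)).
      \<forall>x\<in>c (inv\<^bsub>G\<^esub> g). x \<otimes>\<^bsub>opposite S\<^esub> \<epsilon> = x" if "g \<in> carrier G" for g
    using component_left_unit[OF assms(2), of "inv\<^bsub>G\<^esub> g"] that by (simp add: ring_setmult_opposite)
  from op.left_artinian_iff[OF assms(1) this]
  have "right_artinian S \<longleftrightarrow> right_artinian (S\<lparr>carrier := c \<one>\<^bsub>G\<^esub>\<rparr>) \<and> finite {g \<in> carrier G. c g \<noteq> {\<zero>\<^bsub>S\<^esub>}}"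
    by (simp add: opposite_update_carrier left_artinian_opposite fin)
  moreover note left_artinian_iff[OF assms(1) component_right_unit[OF assms(2)]]
  ultimately show ?thesis by blast
qed

end
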